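(* Let $M$ be a monoid where the $\mathcal{J}$-class of the identity is a sofic group $G$, and suppose that for every non-unit $\mathcal{D}$-class $D$ of $M$, either or both of the following conditions hold: (i) there are finitely many $\mathcal{L}$-classes in $D$, and the Schützenberger group of $D$ is amenable; or (ii) the Schützenberger group of $D$ is finite or abelian, and the $\circ$-action of $G$ on the set of $\mathcal{H}$-classes in $D$ is locally amenable. Then $M$ is sofic.
   Context: Sofic monoids: Let $M$ be a monoid with identity $1$. For a finite subset $K \subseteq M$ and $\epsilon > 0$, a (left) $(K,\epsilon)$-action of $M$ on a non-empty finite set $X$ is a map $M \times X \to X$, $(m,x) \mapsto m \cdot x$ (not required to be an action) such that: (1) $1 \cdot x = x$ for all $x \in X$; (2) for all $g,h \in K$, the proportion of elements $x \in X$ with $g \cdot (h \cdot x) = (gh)\cdot x$ is at least $1-\epsilon$; (3) for all $g,h \in K$ with $g \neq h$, the proportion of elements $x \in X$ with $g \cdot x = h \cdot x$ is at most $\epsilon$. The monoid $M$ is (left) sofic, or simply sofic, if for every finite $K \subseteq M$ and every $\epsilon > 0$ there exist a non-empty finite set $X$ and a $(K,\epsilon)$-action of $M$ on $X$. A sofic group is a group that is sofic in the usual sense; this is known to be equivalent to being sofic as a monoid, i.e. to the condition that for every finite subset $K$ of the group and every $\epsilon > 0$ there exist a non-empty finite set $X$ and a $(K,\epsilon)$-action of the group on $X$. Green's relations on $M$ are the equivalence relations: $x \mathcal{L} y$ iff $Mx = My$; $x \mathcal{R} y$ iff $xM = yM$; $x \mathcal{H} y$ iff both $x \mathcal{L}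 y$ and $x \mathcal{R} y$; $x \mathcal{J} y$ iff $MxM = MyM$; $x \mathcal{D} y$ iff there exists $z \in M$ with $x \mathcal{L} z$ and $z \mathcal{R} y$. If the $\mathcal{J}$-class of $1$ is a group $G$ (under the multiplication of $M$), then $G$ is the group of units of $M$; a non-unit $\mathcal{D}$-class is a $\mathcal{D}$-class of $M$ consisting of non-units, i.e. contained in $M \setminus G$. Schützenberger groups: for an $\mathcal{H}$-class $H$ of $M$, let $\Sigma_H$ be the symmetric group on $H$, acting on $H$ from the right with composition from left to right. The (right) Schützenberger group of $H$ is the subgroup $\{\sigma \in \Sigma_H \mid \text{there exists } m \in M \text{ with } h\sigma = hm \text{ for all } h \in H\}$ of $\Sigma_H$. All $\mathcal{H}$-classes in a single $\mathcal{D}$-class $D$ have isomorphic Schützenberger groups, and the Schützenberger group of $D$ means this group (up to isomorphism). The $\circ$-action: the right translation action of the group of units $G$ on $M$ preserves $\mathcal{R}$-classes (that is, $mg \mathcal{R} m$ for all $m \in M$, $g \in G$) and respects the relation $\mathcal{H}$, so it induces an action $\circ$ of $G$ on the set of $\mathcal{H}$-classes, sending the $\mathcal{H}$-class of $m$, acted on by $g$, to the $\mathcal{H}$-class of $mg$; this restricts to an action on the set of $\mathcal{H}$-classes contained in any given $\mathcal{D}$-class. Locally amenable action: an action of a group $G$ on a set $X$ is locally amenable if for every orbit in $X$, the quotient of $G$ by the pointwise stabiliser of the orbit (a normal subgroup of $G$) is an amenable (discrete) group. *)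

theory Defs
  imports Complex_Main "HOL-Algebra.Group_Action"
begin

section \<open>Sofic monoids and sofic groups\<close>

definition proportion :: "'x set \<Rightarrow> ('x \<Rightarrow> bool) \<Rightarrow> real" where
  "proportion X P = real (card {x \<in> X. P x}) / real (card X)"

definition approx_action ::
  "('a, 'b) monoid_scheme \<Rightarrow> 'a set \<Rightarrow> real \<Rightarrow> 'x set \<Rightarrow> ('a \<Rightarrow> 'x \<Rightarrow> 'x) \<Rightarrow> bool" where
  "approx_action M K \<epsilon> X act \<longleftrightarrow>
     act \<in> carrier M \<rightarrow> (X \<rightarrow> X) \<and>
     (\<forall>x\<in>X. act \<one>\<^bsub>M\<^esub> x = x) \<and>
     (\<forall>g\<in>K. \<forall>h\<in>K. proportion X (\<lambda>x. act g (act h x) = act (g \<otimes>\<^bsub>M\<^esub> h) x) \<ge> 1 - \<epsilon>) \<and>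
     (\<forall>g\<in>K. \<forall>h\<in>K. g \<noteq> h \<longrightarrow> proportion X (\<lambda>x. act g x = act h x) \<le> \<epsilon>)"

text \<open>Up to relabelling, every finite set is a finite set of natural numbers; this is why it is
  enough to let \<open>X\<close> range over finite sets of natural numbers here and below.\<close>

definition sofic_monoid :: "('a, 'b) monoid_scheme \<Rightarrow> bool" where
  "sofic_monoid M \<longleftrightarrow> monoid M \<and>
     (\<forall>K \<epsilon>. finite K \<longrightarrow> K \<subseteq> carrier M \<longrightarrow> \<epsilon> > 0 \<longrightarrow>
        (\<exists>(X::nat set) act. finite X \<and> X \<noteq> {} \<and> approx_action M K \<epsilon> X act))"

text \<open>Soficity of a group in the usual sense: maps into finite symmetric groups that are almost
  multiplicative and almost free with respect to the normalised Hamming distance.\<close>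

definition hamming_dist :: "'x set \<Rightarrow> ('x \<Rightarrow> 'x) \<Rightarrow> ('x \<Rightarrow> 'x) \<Rightarrow> real" where
  "hamming_dist X \<sigma> \<tau> = proportion X (\<lambda>x. \<sigma> x \<noteq> \<tau> x)"

definition sofic_group :: "('a, 'b) monoid_scheme \<Rightarrow> bool" where
  "sofic_group G \<longleftrightarrow> group G \<and>
     (\<forall>K \<epsilon>. finite K \<longrightarrow> K \<subseteq> carrier G \<longrightarrow> \<epsilon> > 0 \<longrightarrow>
        (\<exists>(X::nat set) \<phi>. finite X \<and> X \<noteq> {} \<and>
           \<phi> \<in> carrier G \<rightarrow> carrier (BijGroup X) \<and>
           (\<forall>g\<in>K. \<forall>h\<in>K.
              hamming_dist X (\<phi> (g \<otimes>\<^bsub>G\<^esub> h)) (\<phi> g \<otimes>\<^bsub>BijGroup X\<^esub> \<phi> h) \<le> \<epsilon>) \<and>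
           (\<forall>g\<in>K. \<forall>h\<in>K. g \<noteq> h \<longrightarrow> hamming_dist X (\<phi> g) (\<phi> h) \<ge> 1 - \<epsilon>)))"


section \<open>Green's relations\<close>

definition green_L :: "('a, 'b) monoid_scheme \<Rightarrow> 'a rel" where
  "green_L M = {(x, y) \<in> carrier M \<times> carrier M. carrier M #>\<^bsub>M\<^esub> x = carrier M #>\<^bsub>M\<^esub> y}"

definition green_R :: "('a, 'b) monoid_scheme \<Rightarrow> 'a rel" where
  "green_R M = {(x, y) \<in> carrier M \<times> carrier M. x <#\<^bsub>M\<^esub> carrier M = y <#\<^bsub>M\<^esub> carrier M}"

definition green_H :: "('a, 'b) monoid_scheme \<Rightarrow> 'a rel" where
  "green_H M = green_L M \<inter> green_R M"

definition green_J :: "('a, 'b) monoid_scheme \<Rightarrow> 'a rel" where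
  "green_J M = {(x, y) \<in> carrier M \<times> carrier M.
     carrier M #>\<^bsub>M\<^esub> x <#>\<^bsub>M\<^esub> carrier M = carrier M #>\<^bsub>M\<^esub> y <#>\<^bsub>M\<^esub> carrier M}"

definition green_D :: "('a, 'b) monoid_scheme \<Rightarrow> 'a rel" where
  "green_D M = green_L M O green_R M"

definition J_class_of_one :: "('a, 'b) monoid_scheme \<Rightarrow> ('a, 'b) monoid_scheme" where
  "J_class_of_one M = M\<lparr>carrier := green_J M `` {\<one>\<^bsub>M\<^esub>}\<rparr>"


section \<open>Schuetzenberger groups\<close>

text \<open>Permutations are composed from left to right, so this is the opposite of
  \<^term>\<open>BijGroup H\<close>.\<close>

definition right_sym_group :: "'a set \<Rightarrow> ('a \<Rightarrow> 'a) monoid" where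
  "right_sym_group H =
     \<lparr>carrier = Bij H, mult = (\<lambda>\<sigma> \<tau>. compose H \<tau> \<sigma>), one = (\<lambda>h\<in>H. h)\<rparr>"

definition schutzenberger_group ::
  "('a, 'b) monoid_scheme \<Rightarrow> 'a set \<Rightarrow> ('a \<Rightarrow> 'a) monoid" where
  "schutzenberger_group M H = (right_sym_group H)
     \<lparr>carrier := {\<sigma> \<in> carrier (right_sym_group H).
                    \<exists>m\<in>carrier M. \<forall>h\<in>H. \<sigma> h = h \<otimes>\<^bsub>M\<^esub> m}\<rparr>"

text \<open>The Schuetzenberger group of a \<open>\<D>\<close>-class is only defined up to isomorphism;
  we take that of an arbitrarily chosen \<open>\<H>\<close>-class inside it.\<close>

definition D_schutzenberger_group ::
  "('a, 'b) monoid_scheme \<Rightarrow> 'a set \<Rightarrow> ('a \<Rightarrow> 'a) monoid" where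
  "D_schutzenberger_group M D =
     schutzenberger_group M (SOME H. H \<in> carrier M // green_H M \<and> H \<subseteq> D)"


section \<open>Amenability\<close>

text \<open>Amenability of a discrete group: there is a left-invariant finitely additive probability
  measure defined on all subsets.\<close>

definition amenable_group :: "('a, 'b) monoid_scheme \<Rightarrow> bool" where
  "amenable_group G \<longleftrightarrow> group G \<and>
     (\<exists>\<mu> :: 'a set \<Rightarrow> real.
        (\<forall>A. A \<subseteq> carrier G \<longrightarrow> \<mu> A \<ge> 0) \<and>
        \<mu> (carrier G) = 1 \<and>
        (\<forall>A B. A \<subseteq> carrier G \<longrightarrow> B \<subseteq> carrier G \<longrightarrow> A \<inter> B = {} \<longrightarrow> \<mu> (A \<union> B) = \<mu> A + \<mu> B) \<and>
        (\<forall>g\<in>carrier G. \<forall>A. A \<subseteq> carrier G \<longrightarrow> \<mu> (g <#\<^bsub>G\<^esub> A) = \<mu> A))"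

text \<open>Here \<open>\<phi> g x\<close> is the result of acting on \<open>x\<close> by \<open>g\<close>. Orbits and stabilisers depend only
  on the maps \<open>\<phi> g\<close>, so the two definitions below serve for right actions as well as left ones.\<close>

definition pointwise_stabilizer ::
  "('g, 'b) monoid_scheme \<Rightarrow> ('g \<Rightarrow> 'x \<Rightarrow> 'x) \<Rightarrow> 'x set \<Rightarrow> 'g set" where
  "pointwise_stabilizer G \<phi> Y = {g \<in> carrier G. \<forall>y\<in>Y. \<phi> g y = y}"

definition locally_amenable ::
  "('g, 'b) monoid_scheme \<Rightarrow> 'x set \<Rightarrow> ('g \<Rightarrow> 'x \<Rightarrow> 'x) \<Rightarrow> bool" where
  "locally_amenable G X \<phi> \<longleftrightarrow>
     (\<forall>Y \<in> orbits G X \<phi>. amenable_group (G Mod pointwise_stabilizer G \<phi> Y))"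

text \<open>The right action of units on \<open>\<H>\<close>-classes, lifted from translation
  of representatives to classes.\<close>

definition circ_action :: "('a, 'b) monoid_scheme \<Rightarrow> 'a \<Rightarrow> 'a set \<Rightarrow> 'a set" where
  "circ_action M g C = green_H M `` (C #>\<^bsub>M\<^esub> g)"

end

theory Submission
  imports Defs "HOL-Algebra.FiniteProduct" "HOL-Algebra.Product_Groups"
begin

text \<open>
  Write \<open>G\<close> for the group of units of \<open>M\<close>, that is, the \<open>\<J>\<close>-class of the identity. The non-units form
  an ideal, because a factor of a unit is a unit. Fix a finite set \<open>K\<close>.

  The approximate action of \<open>M\<close> lives on a huge main part together with a negligible remainder, so
  its conditions need only be checked on the main part. Units act on the main part through a sofic
  approximation of \<open>G\<close>, and a non-unit should send a point to the remainder, which consists of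
  elements of \<open>M\<close> on which everything acts by left multiplication. If a point carries a unit \<open>y\<close> as a
  coordinate, moved by units by left multiplication, then sending it to \<open>m y\<close> is consistent
  with the multiplication of \<open>M\<close> and separates distinct non-units. Since the main part is finite, \<open>y\<close>
  can only range over a finite set of units, and it may be known only modulo those units \<open>n\<close> that satisfy
  \<open>m x n = m x\<close> for all units \<open>x\<close> and all non-units \<open>m\<close> in \<open>K\<close>. So a finite
  almost invariant subset of \<open>G/N\<close> is needed, where \<open>N\<close> is the subgroup of these \<open>n\<close>. Such
  sets exist when \<open>G/N\<close> is amenable. This construction is carried out in \<open>exists_approx_action\<close>.

  The hypotheses on \<open>\<D>\<close>-classes give the almost invariant sets. Let \<open>k\<close> be a non-unit. The units that fix
  every \<open>\<H>\<close>-class of the orbit of \<open>k\<close> form a normal subgroup \<open>P\<close> of \<open>G\<close>. The quotient \<open>G/P\<close> is amenable by local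
  amenability, or finite if there are finitely many \<open>\<L>\<close>-classes. An element of \<open>P\<close>
  permutes each of these \<open>\<H>\<close>-classes by an element of a copy of the Schuetzenberger group, and it fixes a point
  only if it fixes the whole \<open>\<H>\<close>-class (\<open>hom_to_schutzenberger_group\<close>). So \<open>P\<close> modulo the
  subgroup that fixes \<open>k x\<close> for all units \<open>x\<close> embeds in a power of the Schuetzenberger group. Finitely many
  factors suffice if there are finitely many \<open>\<L>\<close>-classes, and then amenability of the factor is enough;
  an arbitrary power is abelian or locally finite if the factor is abelian or finite. Extensions
  and finite intersections then lead from single non-units to all of \<open>K\<close>.

  Amenability is given by finitely additive measures but used through the Folner condition. The
  passage between the two goes through Hall's theorem: a group without almost invariant finite sets
  admits a paradoxical decomposition with finitely many translations.
\<close>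

section \<open>Hall's marriage theorem for infinite families\<close>

text \<open>The key step of Rado's proof. If deleting \<open>x\<close> violates Hall's condition at \<open>J \<union> {i}\<close> and deleting \<open>y\<close>
  violates it at \<open>J' \<union> {i}\<close>, then counting the union and the intersection of the two neighbourhoods
  contradicts the condition at \<open>J \<union> J' \<union> {i}\<close> and \<open>J \<inter> J'\<close>.\<close>

lemma hall_condition_delete_one:
  fixes A :: "'i \<Rightarrow> 'a set"
  assumes fin: "\<And>i. i \<in> I \<Longrightarrow> finite (A i)"
    and hall: "\<And>J. finite J \<Longrightarrow> J \<subseteq> I \<Longrightarrow> card J \<le> card (\<Union>(A ` J))"
    and i: "i \<in> I" and xy: "x \<in> A i" "y \<in> A i" "x \<noteq> y"
  shows "\<exists>z\<in>{x, y}. \<forall>J. finite J \<longrightarrow> J \<subseteq> I \<longrightarrow> card J \<le> card (\<Union>((A(i := A i - {z})) ` J))"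
proof (rule ccontr)
  assume neg: "\<not> ?thesis"
  have violated: "\<exists>J. finite J \<and> J \<subseteq> I - {i} \<and> card ((A i - {z}) \<union> \<Union>(A ` J)) \<le> card J"
    if "z \<in> {x, y}" for z
  proof -
    have "\<not> (\<forall>J. finite J \<longrightarrow> J \<subseteq> I \<longrightarrow> card J \<le> card (\<Union>((A(i := A i - {z})) ` J)))"
      using neg that by blast
    then obtain J where J: "finite J" "J \<subseteq> I" "card (\<Union>((A(i := A i - {z})) ` J)) < card J"
      unfolding not_all not_imp not_le by blast
    have "i \<in> J"
    proof (rule ccontr)
      assume "i \<notin> J"
      then have "\<Union>((A(i := A i - {z})) ` J) = \<Union>(A ` J)" by auto
      then show False using hall[OF J(1,2)] J(3) by simp
    qed
    moreover have "\<Union>((A(i := A i - {z})) ` J) = (A i - {z}) \<union> \<Union>(A ` (J - {i}))"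
      using \<open>i \<in> J\<close> by auto
    ultimately show ?thesis
      using J by (intro exI[of _ "J - {i}"]) (auto simp: card_Diff_singleton_if)
  qed
  obtain J where J: "finite J" "J \<subseteq> I - {i}" "card ((A i - {x}) \<union> \<Union>(A ` J)) \<le> card J"
    using violated[OF insertI1] by blast
  obtain J' where J': "finite J'" "J' \<subseteq> I - {i}" "card ((A i - {y}) \<union> \<Union>(A ` J')) \<le> card J'"
    using violated[OF insertI2[OF singletonI]] by blast
  let ?P = "(A i - {x}) \<union> \<Union>(A ` J)" and ?Q = "(A i - {y}) \<union> \<Union>(A ` J')"
  have finP: "finite ?P" and finQ: "finite ?Q" using J J' fin i by auto
  have "card (insert i (J \<union> J')) \<le> card (\<Union>(A ` insert i (J \<union> J')))"
    using J J' i by (intro hall) auto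
  also have "\<Union>(A ` insert i (J \<union> J')) = ?P \<union> ?Q" using xy by auto
  finally have 1: "card (J \<union> J') + 1 \<le> card (?P \<union> ?Q)" using J J' by (subst (asm) card_insert_disjoint) auto
  have "card (J \<inter> J') \<le> card (\<Union>(A ` (J \<inter> J')))" using J by (intro hall) auto
  also have "\<dots> \<le> card (?P \<inter> ?Q)" using finP by (intro card_mono) auto
  finally have 2: "card (J \<inter> J') \<le> card (?P \<inter> ?Q)" .
  have "card J + card J' = card (J \<union> J') + card (J \<inter> J')" using J J' by (intro card_Un_Int)
  moreover have "card ?P + card ?Q = card (?P \<union> ?Q) + card (?P \<inter> ?Q)"
    using finP finQ by (intro card_Un_Int)
  ultimately show False using 1 2 J(3) J'(3) by linarith
qed

text \<open>By Zorn's lemma there is a maximal set of deletions that preserves Hall's condition. The condition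
  passes to unions of chains because the sets \<open>A i\<close> are finite. By maximality and the previous lemma,
  what remains of each \<open>A i\<close> is a single element, and Hall's condition for pairs makes these distinct.\<close>

theorem hall_marriage_infinite:
  fixes A :: "'i \<Rightarrow> 'a set"
  assumes fin: "\<And>i. i \<in> I \<Longrightarrow> finite (A i)"
    and hall: "\<And>J. finite J \<Longrightarrow> J \<subseteq> I \<Longrightarrow> card J \<le> card (\<Union>(A ` J))"
  shows "\<exists>f. inj_on f I \<and> (\<forall>i\<in>I. f i \<in> A i)"
proof -
  define B where "B D i = {a \<in> A i. (i, a) \<notin> D}" for D i
  define \<D> where "\<D> = {D. \<forall>J. finite J \<longrightarrow> J \<subseteq> I \<longrightarrow> card J \<le> card (\<Union>(B D ` J))}"
  have "\<exists>D\<in>\<D>. \<forall>X\<in>\<D>. D \<subseteq> X \<longrightarrow> X = D"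
  proof (rule subset_Zorn_nonempty)
    have "B {} = A" by (auto simp: B_def)
    then show "\<D> \<noteq> {}" using hall by (auto simp: \<D>_def intro!: exI[of _ "{}"])
  next
    fix C assume C: "C \<noteq> {}" "subset.chain \<D> C"
    show "\<Union>C \<in> \<D>" unfolding \<D>_def mem_Collect_eq
    proof (intro allI impI)
      fix J assume J: "finite J" "J \<subseteq> I"
      \<comment> \<open>only finitely many pairs matter for \<open>J\<close>, and one member of the chain contains them\<close>
      have "finite (\<Union>C \<inter> Sigma J A)" using J fin by (intro finite_Int disjI2 finite_SigmaI) auto
      then obtain D where D: "D \<in> C" "\<Union>C \<inter> Sigma J A \<subseteq> D"
        using finite_subset_Union_chain[of "\<Union>C \<inter> Sigma J A" C \<D>] C by auto
      have "B (\<Union>C) i = B D i" if "i \<in> J" for i using D that by (auto simp: B_def)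
      then have "\<Union>(B (\<Union>C) ` J) = \<Union>(B D ` J)" by auto
      moreover have "D \<in> \<D>" using C D by (auto simp: subset_chain_def)
      ultimately show "card J \<le> card (\<Union>(B (\<Union>C) ` J))" using J by (auto simp: \<D>_def)
    qed
  qed
  then obtain D where D: "D \<in> \<D>" and max: "\<And>X. X \<in> \<D> \<Longrightarrow> D \<subseteq> X \<Longrightarrow> X = D" by blast
  have hallD: "card J \<le> card (\<Union>(B D ` J))" if "finite J" "J \<subseteq> I" for J
    using D that by (auto simp: \<D>_def)
  have finD: "finite (B D i)" if "i \<in> I" for i using fin[OF that] by (auto simp: B_def)
  have uniq: "x = y" if i: "i \<in> I" and xy: "x \<in> B D i" "y \<in> B D i" for i x y
  proof (rule ccontr)
    assume "x \<noteq> y"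
    then have "\<exists>z\<in>{x, y}. \<forall>J. finite J \<longrightarrow> J \<subseteq> I \<longrightarrow> card J \<le> card (\<Union>(((B D)(i := B D i - {z})) ` J))"
      by (intro hall_condition_delete_one finD hallD i xy)
    then obtain z where z: "z \<in> {x, y}"
      "\<forall>J. finite J \<longrightarrow> J \<subseteq> I \<longrightarrow> card J \<le> card (\<Union>(((B D)(i := B D i - {z})) ` J))"
      by blast
    have "B (insert (i, z) D) = (B D)(i := B D i - {z})" by (intro ext) (auto simp: B_def)
    then have "insert (i, z) D \<in> \<D>" using z by (simp add: \<D>_def)
    from max[OF this subset_insertI] have "(i, z) \<in> D" by blast
    then show False using z xy by (auto simp: B_def)
  qed
  have "\<exists>x. x \<in> B D i" if "i \<in> I" for i
    using hallD[of "{i}"] that by (auto simp: card_gt_0_iff Suc_le_eq)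
  then obtain f where f: "\<And>i. i \<in> I \<Longrightarrow> f i \<in> B D i" by metis
  have "inj_on f I"
  proof (rule inj_onI, rule ccontr)
    fix i j assume ij: "i \<in> I" "j \<in> I" "f i = f j" "i \<noteq> j"
    have "B D k \<subseteq> {f k}" if "k \<in> I" for k using f[OF that] uniq[OF that] by blast
    then have "\<Union>(B D ` {i, j}) \<subseteq> {f i}" using ij by (metis UN_least insertE singletonD)
    then have "card (\<Union>(B D ` {i, j})) \<le> 1" using card_mono[of "{f i}" "\<Union>(B D ` {i, j})"] by simp
    then show False using hallD[of "{i, j}"] ij by simp
  qed
  then show ?thesis using f by (auto simp: B_def)
qed

section \<open>Amenable groups satisfy the Folner condition\<close>

definition folner_group :: "('a, 'b) monoid_scheme \<Rightarrow> bool" where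
  "folner_group G \<longleftrightarrow> (\<forall>K (\<epsilon>::real). finite K \<longrightarrow> K \<subseteq> carrier G \<longrightarrow> \<epsilon> > 0 \<longrightarrow>
     (\<exists>F. finite F \<and> F \<noteq> {} \<and> F \<subseteq> carrier G \<and>
        (\<forall>k\<in>K. real (card {x \<in> F. k \<otimes>\<^bsub>G\<^esub> x \<notin> F}) \<le> \<epsilon> * real (card F))))"

lemma folner_groupE:
  fixes G (structure) and \<epsilon> :: real
  assumes "folner_group G" "finite K" "K \<subseteq> carrier G" "\<epsilon> > 0"
  obtains F where "finite F" "F \<noteq> {}" "F \<subseteq> carrier G"
    "\<And>k. k \<in> K \<Longrightarrow> real (card {x \<in> F. k \<otimes> x \<notin> F}) \<le> \<epsilon> * real (card F)"
proof -
  have "\<exists>F. finite F \<and> F \<noteq> {} \<and> F \<subseteq> carrier G \<and>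
        (\<forall>k\<in>K. real (card {x \<in> F. k \<otimes> x \<notin> F}) \<le> \<epsilon> * real (card F))"
    using assms unfolding folner_group_def by simp
  then show ?thesis using that by (elim exE conjE) simp
qed

lemma finitely_additive_UN:
  fixes \<mu> :: "'a set \<Rightarrow> real"
  assumes add: "\<And>A B. A \<subseteq> \<Omega> \<Longrightarrow> B \<subseteq> \<Omega> \<Longrightarrow> A \<inter> B = {} \<Longrightarrow> \<mu> (A \<union> B) = \<mu> A + \<mu> B"
    and "finite I" and "\<And>i. i \<in> I \<Longrightarrow> P i \<subseteq> \<Omega>"
    and "\<And>i j. i \<in> I \<Longrightarrow> j \<in> I \<Longrightarrow> i \<noteq> j \<Longrightarrow> P i \<inter> P j = {}"
  shows "\<mu> (\<Union>i\<in>I. P i) = (\<Sum>i\<in>I. \<mu> (P i))"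
  using assms(2-)
proof (induction I)
  case empty
  show ?case using add[of "{}" "{}"] by simp
next
  case (insert i I)
  have "\<mu> (P i \<union> (\<Union>j\<in>I. P j)) = \<mu> (P i) + \<mu> (\<Union>j\<in>I. P j)"
  proof (rule add)
    have "P i \<inter> P j = {}" if "j \<in> I" for j
      using insert.prems(2)[of i j] insert.hyps that by (metis insertCI)
    then show "P i \<inter> (\<Union>j\<in>I. P j) = {}" by auto
  qed (use insert.prems(1) in auto)
  then show ?case using insert by simp
qed

text \<open>If no finite set is almost invariant, then multiplying by \<open>K \<union> {1}\<close> enlarges every finite set by the
  factor \<open>1 + \<epsilon>\<close>. Iterating this yields a finite \<open>E\<close> that doubles every finite set, which is Hall's condition for
  two disjoint copies of the group.\<close>

lemma (in group) not_folner_imp_doubling: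
  assumes K: "finite K" "K \<subseteq> carrier G" and \<epsilon>: "\<epsilon> > (0::real)"
    and no: "\<And>F. finite F \<Longrightarrow> F \<noteq> {} \<Longrightarrow> F \<subseteq> carrier G \<Longrightarrow>
      \<exists>k\<in>K. \<epsilon> * real (card F) < real (card {x \<in> F. k \<otimes> x \<notin> F})"
  shows "\<exists>E. finite E \<and> E \<subseteq> carrier G \<and>
    (\<forall>F. finite F \<longrightarrow> F \<subseteq> carrier G \<longrightarrow> 2 * card F \<le> card (E <#> F))"
proof -
  have grow: "(1 + \<epsilon>) * real (card W) \<le> real (card (W \<union> (K <#> W)))"
    if W: "finite W" "W \<subseteq> carrier G" for W
  proof (cases "W = {}")
    case False
    then obtain k where k: "k \<in> K" "\<epsilon> * real (card W) < real (card {x \<in> W. k \<otimes> x \<notin> W})"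
      using no W by blast
    let ?B = "{x \<in> W. k \<otimes> x \<notin> W}"
    have "inj_on ((\<otimes>) k) ?B" using k(1) K W by (intro inj_onI) (auto simp: subset_iff)
    then have "card W + card ?B = card (W \<union> (\<otimes>) k ` ?B)"
      using W by (subst card_Un_disjoint) (auto simp: card_image)
    also have "\<dots> \<le> card (W \<union> (K <#> W))"
      using W K k(1) by (intro card_mono) (auto simp: set_mult_def)
    finally show ?thesis using k(2) by (simp add: algebra_simps)
  qed simp
  define E where "E n = ((\<lambda>E. E \<union> (K <#> E)) ^^ n) {\<one>}" for n
  have E: "finite (E n) \<and> E n \<subseteq> carrier G" for n
  proof (induction n)
    case (Suc n)
    then show ?case using K by (auto simp: E_def set_mult_def intro!: m_closed)
  qed (simp add: E_def)
  have card_E: "(1 + \<epsilon>) ^ n * real (card F) \<le> real (card (E n <#> F))"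
    if F: "finite F" "F \<subseteq> carrier G" for F n
  proof (induction n)
    case 0
    have "E 0 <#> F = F" using F by (force simp: E_def set_mult_def subset_iff)
    then show ?case by simp
  next
    case (Suc n)
    have fin: "finite (E n <#> F)" using E F by (simp add: set_mult_def)
    have "E (Suc n) <#> F = (E n <#> F) \<union> ((K <#> E n) <#> F)"
      by (auto simp: E_def set_mult_def)
    also have "(K <#> E n) <#> F = K <#> (E n <#> F)"
      using set_mult_assoc K E F by simp
    finally have eq: "E (Suc n) <#> F = (E n <#> F) \<union> (K <#> (E n <#> F))" .
    have "(1 + \<epsilon>) ^ Suc n * real (card F) \<le> (1 + \<epsilon>) * real (card (E n <#> F))"
      using Suc \<epsilon> by (simp add: mult.assoc mult_left_mono)
    also have "\<dots> \<le> real (card (E (Suc n) <#> F))"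
      unfolding eq using grow fin E F set_mult_closed by simp
    finally show ?case .
  qed
  obtain n where n: "2 < (1 + \<epsilon>) ^ n" using real_arch_pow[of "1 + \<epsilon>" 2] \<epsilon> by auto
  have "2 * card F \<le> card (E n <#> F)" if F: "finite F" "F \<subseteq> carrier G" for F
  proof -
    have "2 * real (card F) \<le> (1 + \<epsilon>) ^ n * real (card F)"
      using n by (intro mult_right_mono) auto
    then have "real (2 * card F) \<le> real (card (E n <#> F))" using card_E[OF F, of n] by simp
    then show ?thesis by (simp only: of_nat_le_iff)
  qed
  then show ?thesis using E by blast
qed

text \<open>Hall's theorem turns a doubling set \<open>E\<close> into an injection of two copies of the group into the group
  that moves every point by an element of \<open>E\<close>. Cutting the copies according to the element used shows
  that an invariant measure of total mass 1 would have to accommodate mass 2.\<close>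

theorem amenable_imp_folner:
  fixes G (structure)
  assumes "amenable_group G"
  shows "folner_group G"
proof (rule ccontr)
  interpret group G using assms by (simp add: amenable_group_def)
  obtain \<mu> :: "'a set \<Rightarrow> real" where
    "\<forall>A. A \<subseteq> carrier G \<longrightarrow> 0 \<le> \<mu> A" and total: "\<mu> (carrier G) = 1" and
    "\<forall>A B. A \<subseteq> carrier G \<longrightarrow> B \<subseteq> carrier G \<longrightarrow> A \<inter> B = {} \<longrightarrow> \<mu> (A \<union> B) = \<mu> A + \<mu> B" and
    "\<forall>g\<in>carrier G. \<forall>A. A \<subseteq> carrier G \<longrightarrow> \<mu> (g <# A) = \<mu> A"
    using assms unfolding amenable_group_def by (elim conjE exE) (rule that)
  note nonneg = this(1)[rule_format] and add = this(3)[rule_format] and inv = this(4)[rule_format]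
  assume "\<not> folner_group G"
  then obtain K and \<epsilon> :: real where K: "finite K" "K \<subseteq> carrier G" and \<epsilon>: "\<epsilon> > 0" and
    no: "\<And>F. finite F \<Longrightarrow> F \<noteq> {} \<Longrightarrow> F \<subseteq> carrier G \<Longrightarrow>
      \<exists>k\<in>K. \<epsilon> * real (card F) < real (card {x \<in> F. k \<otimes> x \<notin> F})"
    unfolding folner_group_def by (meson not_le)
  obtain E where E: "finite E" "E \<subseteq> carrier G" and
    double: "\<And>F. finite F \<Longrightarrow> F \<subseteq> carrier G \<Longrightarrow> 2 * card F \<le> card (E <#> F)"
    using not_folner_imp_doubling[OF K \<epsilon> no] by blast
  define I where "I = carrier G \<times> (UNIV :: bool set)"
  define A where "A p = (\<lambda>e. e \<otimes> fst p) ` E" for p :: "'a \<times> bool"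
  have "\<exists>f. inj_on f I \<and> (\<forall>p\<in>I. f p \<in> A p)"
  proof (rule hall_marriage_infinite)
    show "finite (A p)" for p using E by (simp add: A_def)
  next
    fix J assume J: "finite J" "J \<subseteq> I"
    have "card J \<le> card (fst ` J \<times> (UNIV :: bool set))" using J by (intro card_mono) force+
    also have "\<dots> = 2 * card (fst ` J)" by (simp add: card_cartesian_product)
    also have "\<dots> \<le> card (E <#> fst ` J)" using J by (intro double) (auto simp: I_def)
    also have "E <#> fst ` J = \<Union>(A ` J)" by (auto simp: set_mult_def A_def)
    finally show "card J \<le> card (\<Union>(A ` J))" .
  qed
  then obtain f where f: "inj_on f I" "\<And>p. p \<in> I \<Longrightarrow> f p \<in> A p" by blast
  \<comment> \<open>the paradoxical decomposition: \<open>P (e, i)\<close> is the set of points whose \<open>i\<close>-th copy is moved by \<open>e\<close>\<close>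
  define P where "P q = {x \<in> carrier G. f (x, snd q) = fst q \<otimes> x}" for q
  have P: "P q \<subseteq> carrier G" for q by (auto simp: P_def)
  have cover: "(\<Sum>e\<in>E. \<mu> (P (e, i))) = 1" for i
  proof -
    have "(\<Sum>e\<in>E. \<mu> (P (e, i))) = \<mu> (\<Union>e\<in>E. P (e, i))"
    proof (rule finitely_additive_UN[where \<Omega> = "carrier G" and \<mu> = \<mu> and I = E
          and P = "\<lambda>e. P (e, i)", symmetric])
      show "P (e, i) \<inter> P (e', i) = {}" if "e \<in> E" "e' \<in> E" "e \<noteq> e'" for e e'
        using that E by (auto simp: P_def subset_iff)
    qed (use add E P in auto)
    also have "(\<Union>e\<in>E. P (e, i)) = carrier G"
      using f(2) by (force simp: P_def I_def A_def)
    finally show ?thesis by (simp add: total)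
  qed
  have moved: "fst q <# P q = (\<lambda>x. f (x, snd q)) ` P q" for q
    by (auto simp: l_coset_def P_def)
  have sub: "fst q <# P q \<subseteq> carrier G" if "q \<in> E \<times> UNIV" for q
    using that E P by (intro l_coset_subset_G) auto
  have "2 = (\<Sum>i\<in>(UNIV :: bool set). \<Sum>e\<in>E. \<mu> (P (e, i)))" by (simp add: cover)
  also have "\<dots> = (\<Sum>q\<in>E \<times> UNIV. \<mu> (P q))"
    by (subst sum.swap) (simp add: sum.cartesian_product)
  also have "\<dots> = (\<Sum>q\<in>E \<times> UNIV. \<mu> (fst q <# P q))"
    using E P by (intro sum.cong refl inv[symmetric]) auto
  also have "\<dots> = \<mu> (\<Union>q\<in>E \<times> UNIV. fst q <# P q)"
  proof (rule finitely_additive_UN[where \<Omega> = "carrier G" and \<mu> = \<mu> and I = "E \<times> UNIV"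
        and P = "\<lambda>q. fst q <# P q", symmetric])
    fix q q' :: "'a \<times> bool" assume q: "q \<in> E \<times> UNIV" "q' \<in> E \<times> UNIV" "q \<noteq> q'"
    show "(fst q <# P q) \<inter> (fst q' <# P q') = {}"
    proof (rule ccontr)
      assume "\<not> ?thesis"
      then obtain x x' where x: "x \<in> P q" "x' \<in> P q'" "f (x, snd q) = f (x', snd q')"
        unfolding moved by auto
      then have "x = x'" "snd q = snd q'"
        using inj_onD[OF f(1), of "(x, snd q)" "(x', snd q')"] subsetD[OF P]
        by (auto simp: I_def)
      moreover have "fst q = fst q'"
        using x calculation q E by (auto simp: P_def subset_iff)
      ultimately show False using q by (simp add: prod_eq_iff)
    qed
  qed (use add E sub in auto)
  also have "\<dots> \<le> \<mu> (carrier G)"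
  proof -
    let ?U = "\<Union>q\<in>E \<times> UNIV. fst q <# P q"
    have U: "?U \<subseteq> carrier G" using sub by blast
    then have "\<mu> (carrier G) = \<mu> ?U + \<mu> (carrier G - ?U)"
      using add[of ?U "carrier G - ?U"] by (simp add: Un_absorb1)
    then show ?thesis using nonneg[of "carrier G - ?U"] by simp
  qed
  finally show False by (simp add: total)
qed

section \<open>Abelian groups and powers of finite groups\<close>

lemma exists_exponential_exceeds_power:
  fixes \<epsilon> :: real
  assumes "\<epsilon> > 0"
  shows "\<exists>m. real (Suc m) ^ c < (1 + \<epsilon>) ^ m"
proof (cases "c = 0")
  case True
  then show ?thesis using assms by (intro exI[of _ 1]) simp
next
  case False
  define x where "x = 1 / root c (1 + \<epsilon>)"
  have x: "0 < x" "x < 1" "x ^ c = 1 / (1 + \<epsilon>)"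
    using False assms by (auto simp: x_def power_divide)
  have "(\<lambda>n. real (Suc n) * x ^ Suc n) \<longlonglongrightarrow> 0"
    using LIMSEQ_Suc[OF powser_times_n_limit_0[of x]] x by simp
  then have "\<forall>\<^sub>F n in sequentially. real (Suc n) * x ^ Suc n < x"
    using x by (intro order_tendstoD(2)[of _ 0]) auto
  then obtain m where "real (Suc m) * x ^ Suc m < x" by (auto simp: eventually_sequentially)
  then have "(real (Suc m) * x ^ m) * x < 1 * x" by (simp only: power_Suc2 mult.assoc mult_1)
  then have "real (Suc m) * x ^ m < 1" using x by (simp only: mult_less_cancel_right_pos)
  then have "(real (Suc m) * x ^ m) ^ c < 1 ^ c" using x False by (intro power_strict_mono) auto
  moreover have "(real (Suc m) * x ^ m) ^ c = real (Suc m) ^ c / (1 + \<epsilon>) ^ m"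
  proof -
    have "(x ^ m) ^ c = (x ^ c) ^ m" by (metis power_mult mult.commute)
    then show ?thesis by (simp add: power_mult_distrib x(3) power_divide)
  qed
  ultimately have "real (Suc m) ^ c / (1 + \<epsilon>) ^ m < 1" by simp
  then have "real (Suc m) ^ c < (1 + \<epsilon>) ^ m" using assms by (subst (asm) divide_less_eq_1_pos) auto
  then show ?thesis ..
qed

text \<open>The set of products of powers of elements of \<open>K\<close> with exponents at most \<open>m\<close> has at most
  \<open>(m + 1)\<^bsup>card K\<^esup>\<close> elements. This rules out growth by a factor \<open>1 + \<epsilon>\<close> from \<open>m\<close> to \<open>m + 1\<close> at every
  \<open>m\<close>, and at an \<open>m\<close> without such growth the set is almost invariant.\<close>

lemma comm_group_imp_folner:
  fixes G (structure)
  assumes "comm_group G"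
  shows "folner_group G"
  unfolding folner_group_def
proof (intro allI impI)
  interpret comm_group G by fact
  fix K and \<epsilon> :: real assume K: "finite K" "K \<subseteq> carrier G" and \<epsilon>: "\<epsilon> > 0"
  define w where "w e = finprod G (\<lambda>k. k [^] (e k :: nat)) K" for e
  define B where "B m = w ` (K \<rightarrow>\<^sub>E {..m})" for m :: nat
  have fin: "finite (B m)" for m using K by (auto simp: B_def intro!: finite_PiE)
  have w_closed: "w e \<in> carrier G" for e unfolding w_def using K by (intro finprod_closed) auto
  have BG: "B m \<subseteq> carrier G" for m using w_closed by (auto simp: B_def)
  have ne: "B m \<noteq> {}" for m by (auto simp: B_def PiE_eq_empty_iff)
  have step: "k \<otimes> x \<in> B (Suc m)" if k: "k \<in> K" and x: "x \<in> B m" for k x m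
  proof -
    obtain e where e: "e \<in> K \<rightarrow>\<^sub>E {..m}" "x = w e" using x by (auto simp: B_def)
    have split: "w f = k [^] f k \<otimes> finprod G (\<lambda>j. j [^] f j) (K - {k})" for f
    proof -
      have "w f = finprod G (\<lambda>j. j [^] f j) (insert k (K - {k}))" using k by (simp add: w_def insert_absorb)
      also have "\<dots> = k [^] f k \<otimes> finprod G (\<lambda>j. j [^] f j) (K - {k})"
        using K k by (intro finprod_insert) auto
      finally show ?thesis .
    qed
    have kG: "k \<in> carrier G" using k K by auto
    have rest: "finprod G (\<lambda>j. j [^] (e(k := Suc (e k))) j) (K - {k}) = finprod G (\<lambda>j. j [^] e j) (K - {k})"
      using K by (intro finprod_cong') auto
    have restG: "finprod G (\<lambda>j. j [^] e j) (K - {k}) \<in> carrier G" using K by (intro finprod_closed) auto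
    have "w (e(k := Suc (e k))) = k [^] Suc (e k) \<otimes> finprod G (\<lambda>j. j [^] e j) (K - {k})"
      unfolding split rest by simp
    also have "\<dots> = k \<otimes> x"
      unfolding e(2) split[of e] using kG restG by (simp add: m_assoc m_lcomm)
    finally have "k \<otimes> x = w (e(k := Suc (e k)))" ..
    moreover have "e(k := Suc (e k)) \<in> K \<rightarrow>\<^sub>E {..Suc m}" using e(1) k
      by (auto simp: PiE_iff extensional_def le_Suc_eq)
    ultimately show ?thesis by (auto simp: B_def)
  qed
  have mono: "B m \<subseteq> B (Suc m)" for m
    unfolding B_def by (intro image_mono PiE_mono) auto
  have "\<exists>m. real (card (B (Suc m))) \<le> (1 + \<epsilon>) * real (card (B m))"
  proof (rule ccontr)
    assume "\<not> ?thesis"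
    then have grow: "(1 + \<epsilon>) * real (card (B m)) < real (card (B (Suc m)))" for m
      by (auto simp: not_le)
    have "(1 + \<epsilon>) ^ m \<le> real (card (B m))" for m
    proof (induction m)
      case 0
      then show ?case using fin ne by (simp add: Suc_le_eq card_gt_0_iff)
    next
      case (Suc m)
      then have "(1 + \<epsilon>) * (1 + \<epsilon>) ^ m \<le> (1 + \<epsilon>) * real (card (B m))"
        using \<epsilon> by (intro mult_left_mono) auto
      then show ?case using grow[of m] by simp
    qed
    moreover have "card (B m) \<le> Suc m ^ card K" for m
    proof -
      have "card (B m) \<le> card (K \<rightarrow>\<^sub>E {..m})"
        unfolding B_def using K by (intro card_image_le finite_PiE) auto
      then show ?thesis using K by (simp add: card_PiE)
    qed
    then have "real (card (B m)) \<le> real (Suc m) ^ card K" for m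
      by (metis of_nat_le_iff of_nat_power)
    ultimately have "(1 + \<epsilon>) ^ m \<le> real (Suc m) ^ card K" for m by (rule order_trans)
    then show False using exists_exponential_exceeds_power[OF \<epsilon>, of "card K"] not_less by blast
  qed
  then obtain m where m: "real (card (B (Suc m))) \<le> (1 + \<epsilon>) * real (card (B m))" ..
  have "real (card {x \<in> B m. k \<otimes> x \<notin> B m}) \<le> \<epsilon> * real (card (B m))" if k: "k \<in> K" for k
  proof -
    let ?S = "{x \<in> B m. k \<otimes> x \<notin> B m}"
    have kG: "k \<in> carrier G" using k K by auto
    have "inj_on ((\<otimes>) k) ?S" using kG BG by (intro inj_onI) (auto simp: subset_iff)
    then have "card ?S = card ((\<otimes>) k ` ?S)" by (simp add: card_image)
    also have "\<dots> \<le> card (B (Suc m) - B m)" using step[OF k] fin by (intro card_mono) auto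
    also have "\<dots> = card (B (Suc m)) - card (B m)" using fin mono by (simp add: card_Diff_subset)
    finally have "card ?S + card (B m) \<le> card (B (Suc m))"
      using card_mono[OF fin mono, of m] by linarith
    then have "real (card ?S) + real (card (B m)) \<le> real (card (B (Suc m)))"
      by (simp flip: of_nat_add)
    then show ?thesis using m by (simp add: algebra_simps)
  qed
  then show "\<exists>F. finite F \<and> F \<noteq> {} \<and> F \<subseteq> carrier G \<and>
      (\<forall>k\<in>K. real (card {x \<in> F. k \<otimes> x \<notin> F}) \<le> \<epsilon> * real (card F))"
    using fin BG ne by (intro exI[of _ "B m"]) simp
qed

lemma comm_group_product_group:
  assumes "\<And>i. i \<in> I \<Longrightarrow> comm_group (\<Gamma> i)"
  shows "comm_group (product_group I \<Gamma>)"
proof (rule group.group_comm_groupI)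
  show "group (product_group I \<Gamma>)" using assms by (simp add: comm_group_def)
  fix x y assume "x \<in> carrier (product_group I \<Gamma>)" "y \<in> carrier (product_group I \<Gamma>)"
  then show "x \<otimes>\<^bsub>product_group I \<Gamma>\<^esub> y = y \<otimes>\<^bsub>product_group I \<Gamma>\<^esub> x"
    using assms by (auto simp: comm_group_def intro!: ext comm_monoid.m_comm)
qed

text \<open>Such a power is locally finite. The coordinates are classified by the values of the elements of
  \<open>K\<close> there, and there are only finitely many types. The functions that depend on the type alone
  form a finite subgroup containing \<open>K\<close>.\<close>

lemma power_of_finite_group_folner:
  fixes \<Gamma> (structure)
  assumes "group \<Gamma>" and fin: "finite (carrier \<Gamma>)"
  shows "folner_group (product_group I (\<lambda>_. \<Gamma>))"
  unfolding folner_group_def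
proof (intro allI impI)
  interpret group \<Gamma> by fact
  let ?P = "product_group I (\<lambda>_. \<Gamma>)"
  fix K and \<epsilon> :: real assume K: "finite K" "K \<subseteq> carrier ?P" and \<epsilon>: "\<epsilon> > 0"
  define \<G> where "\<G> = (K \<rightarrow>\<^sub>E carrier \<Gamma>) \<rightarrow>\<^sub>E carrier \<Gamma>"
  \<comment> \<open>the type of the coordinate \<open>i\<close>\<close>
  define \<tau> where "\<tau> i = (\<lambda>k\<in>K. k i)" for i
  define S where "S = (\<lambda>g. \<lambda>i\<in>I. g (\<tau> i)) ` \<G>"
  have \<tau>: "\<tau> i \<in> K \<rightarrow>\<^sub>E carrier \<Gamma>" if "i \<in> I" for i using K that by (auto simp: \<tau>_def PiE_iff)
  have "finite S"
    using K fin unfolding S_def \<G>_def by (intro finite_imageI finite_PiE) auto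
  moreover have S: "S \<subseteq> carrier ?P" using \<tau> by (auto simp: S_def \<G>_def PiE_iff)
  moreover have "\<one>\<^bsub>?P\<^esub> \<in> S"
    using \<tau> unfolding S_def
    by (intro image_eqI[where x = "\<lambda>t\<in>K \<rightarrow>\<^sub>E carrier \<Gamma>. \<one>"]) (auto simp: \<G>_def fun_eq_iff)
  moreover have mult: "k \<otimes>\<^bsub>?P\<^esub> x \<in> S" if k: "k \<in> K" and x: "x \<in> S" for k x
  proof -
    obtain g where g: "g \<in> \<G>" "x = (\<lambda>i\<in>I. g (\<tau> i))" using x by (auto simp: S_def)
    let ?g = "\<lambda>t\<in>K \<rightarrow>\<^sub>E carrier \<Gamma>. t k \<otimes> g t"
    have "k \<otimes>\<^bsub>?P\<^esub> x = (\<lambda>i\<in>I. ?g (\<tau> i))"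
      using \<tau> k by (auto simp: g(2) fun_eq_iff restrict_def) (auto simp: \<tau>_def)
    moreover have "?g \<in> \<G>" using g(1) k by (auto simp: \<G>_def PiE_iff)
    ultimately show ?thesis unfolding S_def by (intro image_eqI[where x = ?g])
  qed
  have "real (card {x \<in> S. k \<otimes>\<^bsub>?P\<^esub> x \<notin> S}) \<le> \<epsilon> * real (card S)" if "k \<in> K" for k
  proof -
    have empty: "{x \<in> S. k \<otimes>\<^bsub>?P\<^esub> x \<notin> S} = {}" using mult that by blast
    show ?thesis unfolding empty using \<epsilon> by simp
  qed
  ultimately show "\<exists>F. finite F \<and> F \<noteq> {} \<and> F \<subseteq> carrier ?P \<and>
      (\<forall>k\<in>K. real (card {x \<in> F. k \<otimes>\<^bsub>?P\<^esub> x \<notin> F}) \<le> \<epsilon> * real (card F))"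
    by blast
qed

section \<open>The Folner condition modulo a subgroup\<close>

text \<open>The left action of \<open>H\<close> on the coset space \<open>H/N\<close> has almost invariant finite sets. These are given by
  sets \<open>F\<close> of representatives, and \<open>N\<close> need not be normal. In this form subgroups of one group \<open>G\<close> can be
  compared without forming quotients.\<close>

definition folner_mod :: "('a, 'b) monoid_scheme \<Rightarrow> 'a set \<Rightarrow> 'a set \<Rightarrow> bool" where
  "folner_mod G H N \<longleftrightarrow> (\<forall>K (\<epsilon>::real). finite K \<longrightarrow> K \<subseteq> H \<longrightarrow> \<epsilon> > 0 \<longrightarrow>
     (\<exists>F. finite F \<and> F \<noteq> {} \<and> F \<subseteq> H \<and>
        (\<forall>x\<in>F. \<forall>y\<in>F. inv\<^bsub>G\<^esub> x \<otimes>\<^bsub>G\<^esub> y \<in> N \<longrightarrow> x = y) \<and>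
        (\<forall>k\<in>K. real (card {x \<in> F. \<forall>y\<in>F. inv\<^bsub>G\<^esub> y \<otimes>\<^bsub>G\<^esub> (k \<otimes>\<^bsub>G\<^esub> x) \<notin> N}) \<le> \<epsilon> * real (card F))))"

lemma folner_modE:
  fixes G (structure) and \<epsilon> :: real
  assumes "folner_mod G H N" "finite K" "K \<subseteq> H" "\<epsilon> > 0"
  obtains F where "finite F" "F \<noteq> {}" "F \<subseteq> H"
    "\<And>x y. x \<in> F \<Longrightarrow> y \<in> F \<Longrightarrow> inv x \<otimes> y \<in> N \<Longrightarrow> x = y"
    "\<And>k. k \<in> K \<Longrightarrow> real (card {x \<in> F. \<forall>y\<in>F. inv y \<otimes> (k \<otimes> x) \<notin> N}) \<le> \<epsilon> * real (card F)"
proof -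
  have "\<exists>F. finite F \<and> F \<noteq> {} \<and> F \<subseteq> H \<and>
        (\<forall>x\<in>F. \<forall>y\<in>F. inv x \<otimes> y \<in> N \<longrightarrow> x = y) \<and>
        (\<forall>k\<in>K. real (card {x \<in> F. \<forall>y\<in>F. inv y \<otimes> (k \<otimes> x) \<notin> N}) \<le> \<epsilon> * real (card F))"
    using assms unfolding folner_mod_def by simp
  then show ?thesis using that by (elim exE conjE) simp
qed

lemma (in group) mult_inv_cancel_left:
  assumes "x \<in> carrier G" "y \<in> carrier G"
  shows "x \<otimes> (inv x \<otimes> y) = y" "inv x \<otimes> (x \<otimes> y) = y"
  using assms by (simp_all flip: m_assoc)

text \<open>If \<open>c\<close> takes finitely many values and separates the cosets of \<open>N\<close>, then a full transversal is finite and
  exactly invariant.\<close>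

lemma (in group) folner_mod_finite_index:
  assumes H: "subgroup H G" and N: "subgroup N G"
    and c: "finite (c ` H)" "\<And>x y. x \<in> H \<Longrightarrow> y \<in> H \<Longrightarrow> c x = c y \<Longrightarrow> inv x \<otimes> y \<in> N"
  shows "folner_mod G H N"
  unfolding folner_mod_def
proof (intro allI impI)
  fix K and \<epsilon> :: real assume K: "finite K" "K \<subseteq> H" and \<epsilon>: "\<epsilon> > 0"
  have HG: "x \<in> carrier G" if "x \<in> H" for x using H that by (rule subgroup.mem_carrier)
  have sym: "inv y \<otimes> x \<in> N" if "x \<in> H" "y \<in> H" "inv x \<otimes> y \<in> N" for x y
    using subgroup.m_inv_closed[OF N that(3)] HG that by (simp add: inv_mult_group)
  have trans: "inv x \<otimes> z \<in> N"
    if "x \<in> H" "y \<in> H" "z \<in> H" "inv x \<otimes> y \<in> N" "inv y \<otimes> z \<in> N" for x y z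
  proof -
    have "(inv x \<otimes> y) \<otimes> (inv y \<otimes> z) = inv x \<otimes> z"
      using HG that by (simp add: m_assoc mult_inv_cancel_left)
    then show ?thesis using subgroup.m_closed[OF N that(4,5)] by simp
  qed
  define q where "q s = {y \<in> H. inv s \<otimes> y \<in> N}" for s
  have q_eq: "q x = q y" if "x \<in> H" "y \<in> H" "inv x \<otimes> y \<in> N" for x y
    using that sym trans unfolding q_def by blast
  define r where "r A = (SOME y. y \<in> A)" for A :: "'a set"
  have self: "s \<in> q s" if "s \<in> H" for s
    using that HG N by (simp add: q_def subgroup.one_closed)
  have r: "r (q s) \<in> q s" if "s \<in> H" for s
    unfolding r_def using self[OF that] by (rule someI)
  define F where "F = (\<lambda>s. r (q s)) ` H"
  have "finite (q ` H)"
  proof (rule finite_subset)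
    show "q ` H \<subseteq> (\<lambda>v. q (SOME s. s \<in> H \<and> c s = v)) ` c ` H"
    proof
      fix A assume "A \<in> q ` H"
      then obtain s where s: "s \<in> H" "A = q s" by auto
      let ?s = "SOME t. t \<in> H \<and> c t = c s"
      have "?s \<in> H \<and> c ?s = c s" by (rule someI[of _ s]) (use s in simp)
      then have "A = q ?s" using s c(2) q_eq by metis
      then show "A \<in> (\<lambda>v. q (SOME s. s \<in> H \<and> c s = v)) ` c ` H" using s by blast
    qed
  qed (use c(1) in simp)
  then have "finite (r ` q ` H)" by simp
  then have fin: "finite F" by (simp add: F_def image_image)
  have FH: "F \<subseteq> H" using r by (auto simp: F_def q_def)
  have ne: "F \<noteq> {}" using subgroup.one_closed[OF H] by (auto simp: F_def)
  have "x = y" if xy: "x \<in> F" "y \<in> F" "inv x \<otimes> y \<in> N" for x y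
  proof -
    obtain s t where st: "s \<in> H" "t \<in> H" "x = r (q s)" "y = r (q t)"
      using xy unfolding F_def by blast
    have "x \<in> q s" "y \<in> q t" using r st by auto
    then have "q s = q x" "q t = q y" using st(1,2) q_eq unfolding q_def by blast+
    moreover have "q x = q y" using xy FH q_eq by blast
    ultimately show ?thesis using st by simp
  qed
  moreover have none: "{x \<in> F. \<forall>y\<in>F. inv y \<otimes> (k \<otimes> x) \<notin> N} = {}" if "k \<in> K" for k
  proof -
    have "\<exists>y\<in>F. inv y \<otimes> (k \<otimes> x) \<in> N" if "x \<in> F" for x
    proof -
      have kx: "k \<otimes> x \<in> H" using that \<open>k \<in> K\<close> K FH H by (auto intro: subgroup.m_closed)
      then have "r (q (k \<otimes> x)) \<in> H" "inv (k \<otimes> x) \<otimes> r (q (k \<otimes> x)) \<in> N"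
        using r unfolding q_def by auto
      then show ?thesis using sym kx by (auto simp: F_def)
    qed
    then show ?thesis by blast
  qed
  ultimately show "\<exists>F. finite F \<and> F \<noteq> {} \<and> F \<subseteq> H \<and>
        (\<forall>x\<in>F. \<forall>y\<in>F. inv x \<otimes> y \<in> N \<longrightarrow> x = y) \<and>
        (\<forall>k\<in>K. real (card {x \<in> F. \<forall>y\<in>F. inv y \<otimes> (k \<otimes> x) \<notin> N}) \<le> \<epsilon> * real (card F))"
    using fin FH ne \<epsilon> by (intro exI[of _ F]) (simp add: none)
qed

text \<open>This is closure under extensions. If \<open>F1\<close> works for \<open>H/P\<close>, then \<open>k x\<close> is congruent modulo \<open>P\<close> to some
  \<open>y \<in> F1\<close> for most \<open>x \<in> F1\<close>, with finitely many errors \<open>y\<^sup>-\<^sup>1 k x \<in> P\<close>. The product \<open>F1 F2\<close> works for \<open>H/N\<close> if \<open>F2\<close> is almost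
  invariant under these errors.\<close>

lemma (in group) folner_mod_trans:
  assumes H: "subgroup H G" and P: "subgroup P G" "P \<subseteq> H" and N: "subgroup N G" "N \<subseteq> P"
    and HP: "folner_mod G H P" and PN: "folner_mod G P N"
  shows "folner_mod G H N"
  unfolding folner_mod_def
proof (intro allI impI)
  fix K and \<epsilon> :: real assume K: "finite K" "K \<subseteq> H" and \<epsilon>: "\<epsilon> > 0"
  then have \<epsilon>2: "\<epsilon> / 2 > 0" by simp
  have HG: "x \<in> carrier G" if "x \<in> H" for x using H that by (rule subgroup.mem_carrier)
  obtain F1 where F1: "finite F1" "F1 \<noteq> {}" "F1 \<subseteq> H"
    and inj1: "\<And>x y. x \<in> F1 \<Longrightarrow> y \<in> F1 \<Longrightarrow> inv x \<otimes> y \<in> P \<Longrightarrow> x = y"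
    and bad1: "\<And>k. k \<in> K \<Longrightarrow>
      real (card {x \<in> F1. \<forall>y\<in>F1. inv y \<otimes> (k \<otimes> x) \<notin> P}) \<le> \<epsilon> / 2 * real (card F1)"
    using folner_modE[OF HP K \<epsilon>2] by blast
  define K2 where "K2 = (\<lambda>(k, x, y). inv y \<otimes> (k \<otimes> x)) ` (K \<times> F1 \<times> F1) \<inter> P"
  have K2: "finite K2" "K2 \<subseteq> P" using K F1 by (auto simp: K2_def)
  obtain F2 where F2: "finite F2" "F2 \<noteq> {}" "F2 \<subseteq> P"
    and inj2: "\<And>x y. x \<in> F2 \<Longrightarrow> y \<in> F2 \<Longrightarrow> inv x \<otimes> y \<in> N \<Longrightarrow> x = y"
    and bad2: "\<And>k. k \<in> K2 \<Longrightarrow>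
      real (card {x \<in> F2. \<forall>y\<in>F2. inv y \<otimes> (k \<otimes> x) \<notin> N}) \<le> \<epsilon> / 2 * real (card F2)"
    using folner_modE[OF PN K2 \<epsilon>2] by blast
  define m where "m = (\<lambda>(x, p). x \<otimes> p :: 'a)"
  define F where "F = m ` (F1 \<times> F2)"
  have G1: "x \<in> carrier G" if "x \<in> F1" for x using that F1 HG by auto
  have G2: "p \<in> carrier G" if "p \<in> F2" for p using that F2 P HG by auto
  have inj: "x = x' \<and> p = p'"
    if x: "x \<in> F1" "x' \<in> F1" "p \<in> F2" "p' \<in> F2" and n: "inv (x \<otimes> p) \<otimes> (x' \<otimes> p') \<in> N" for x x' p p'
  proof -
    have G: "x \<in> carrier G" "x' \<in> carrier G" "p \<in> carrier G" "p' \<in> carrier G"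
      using G1 G2 x by auto
    have "inv x \<otimes> x' = p \<otimes> (inv (x \<otimes> p) \<otimes> (x' \<otimes> p')) \<otimes> inv p'"
      using G by (simp add: inv_mult_group m_assoc mult_inv_cancel_left)
    also have "\<dots> \<in> P"
    proof -
      have "p \<in> P" "inv p' \<in> P" using x F2 subgroup.m_inv_closed[OF P(1)] by auto
      then show ?thesis using n N(2) subgroup.m_closed[OF P(1)] by blast
    qed
    finally have eq: "x = x'" using inj1 x by blast
    have "inv (x \<otimes> p) \<otimes> (x' \<otimes> p') = inv p \<otimes> p'"
      using G unfolding eq by (simp add: inv_mult_group m_assoc mult_inv_cancel_left)
    then show ?thesis using inj2 x n eq by simp
  qed
  have inj_m: "inj_on m (F1 \<times> F2)"
  proof (rule inj_onI, clarify)
    fix x p x' p' assume x: "x \<in> F1" "x' \<in> F1" "p \<in> F2" "p' \<in> F2" "m (x, p) = m (x', p')"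
    then have "inv (x \<otimes> p) \<otimes> (x' \<otimes> p') = \<one>" using G1 G2 by (simp add: m_def)
    then show "x = x' \<and> p = p'" using inj[of x x' p p'] x subgroup.one_closed[OF N(1)] by simp
  qed
  have cardF: "card F = card F1 * card F2"
    unfolding F_def using inj_m by (simp add: card_image card_cartesian_product)
  have bad: "real (card {z \<in> F. \<forall>w\<in>F. inv w \<otimes> (k \<otimes> z) \<notin> N}) \<le> \<epsilon> * real (card F)"
    if k: "k \<in> K" for k
  proof -
    define B1 where "B1 = {x \<in> F1. \<forall>y\<in>F1. inv y \<otimes> (k \<otimes> x) \<notin> P}"
    define B2 where "B2 n = {x \<in> F2. \<forall>y\<in>F2. inv y \<otimes> (n \<otimes> x) \<notin> N}" for n
    have "\<exists>y. y \<in> F1 \<and> inv y \<otimes> (k \<otimes> x) \<in> P" if "x \<in> F1 - B1" for x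
      using that by (auto simp: B1_def)
    then obtain t where t: "\<And>x. x \<in> F1 - B1 \<Longrightarrow> t x \<in> F1 \<and> inv (t x) \<otimes> (k \<otimes> x) \<in> P"
      by metis
    define n where "n x = inv (t x) \<otimes> (k \<otimes> x)" for x
    have n: "n x \<in> K2" if "x \<in> F1 - B1" for x
      using t[OF that] that k by (force simp: K2_def n_def)
    let ?S = "B1 \<times> F2 \<union> (SIGMA x:F1 - B1. B2 (n x))"
    have finS: "finite ?S" using F1 F2 by (auto simp: B1_def B2_def)
    have "{z \<in> F. \<forall>w\<in>F. inv w \<otimes> (k \<otimes> z) \<notin> N} \<subseteq> m ` ?S"
    proof
      fix z assume z: "z \<in> {z \<in> F. \<forall>w\<in>F. inv w \<otimes> (k \<otimes> z) \<notin> N}"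
      then obtain x p where xp: "x \<in> F1" "p \<in> F2" "z = x \<otimes> p" by (auto simp: F_def m_def)
      have "p \<in> B2 (n x)" if x: "x \<in> F1 - B1"
      proof (rule ccontr)
        assume "p \<notin> B2 (n x)"
        then obtain p' where p': "p' \<in> F2" "inv p' \<otimes> (n x \<otimes> p) \<in> N" using xp by (auto simp: B2_def)
        have "inv (t x \<otimes> p') \<otimes> (k \<otimes> z) = inv p' \<otimes> (n x \<otimes> p)"
          unfolding n_def xp(3) using t[OF x] xp p' k G1 G2 HG K
          by (auto simp: inv_mult_group m_assoc subset_iff)
        moreover have "t x \<otimes> p' \<in> F" using t[OF x] p' by (auto simp: F_def m_def)
        ultimately show False using z p' by auto
      qed
      then have "(x, p) \<in> ?S" using xp by auto
      then show "z \<in> m ` ?S" using xp by (force simp: m_def)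
    qed
    then have "card {z \<in> F. \<forall>w\<in>F. inv w \<otimes> (k \<otimes> z) \<notin> N} \<le> card (m ` ?S)"
      using finS by (intro card_mono) auto
    also have "\<dots> \<le> card ?S" using finS by (rule card_image_le)
    also have "\<dots> \<le> card (B1 \<times> F2) + card (SIGMA x:F1 - B1. B2 (n x))" by (rule card_Un_le)
    also have "\<dots> = card B1 * card F2 + (\<Sum>x\<in>F1 - B1. card (B2 (n x)))"
      using F1 F2 by (simp add: card_cartesian_product B2_def)
    finally have "real (card {z \<in> F. \<forall>w\<in>F. inv w \<otimes> (k \<otimes> z) \<notin> N})
        \<le> real (card B1 * card F2 + (\<Sum>x\<in>F1 - B1. card (B2 (n x))))"
      by (simp only: of_nat_le_iff)
    also have "\<dots> = real (card B1) * real (card F2) + (\<Sum>x\<in>F1 - B1. real (card (B2 (n x))))" by simp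
    also have "\<dots> \<le> (\<epsilon> / 2 * real (card F1)) * real (card F2)
        + (\<Sum>x\<in>F1 - B1. \<epsilon> / 2 * real (card F2))"
      using bad1[OF k] bad2[OF n]
      by (intro add_mono mult_right_mono sum_mono) (auto simp: B1_def B2_def)
    also have "(\<Sum>x\<in>F1 - B1. \<epsilon> / 2 * real (card F2)) \<le> real (card F1) * (\<epsilon> / 2 * real (card F2))"
      using F1 \<epsilon> by (simp add: card_mono mult_right_mono)
    finally show ?thesis by (simp add: cardF algebra_simps)
  qed
  have "x = y" if xy: "x \<in> F" "y \<in> F" "inv x \<otimes> y \<in> N" for x y
  proof -
    obtain a p b q where "a \<in> F1" "b \<in> F1" "p \<in> F2" "q \<in> F2" "x = a \<otimes> p" "y = b \<otimes> q"
      using xy by (auto simp: F_def m_def)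
    then show ?thesis using inj[of a b p q] xy by simp
  qed
  moreover have "F \<subseteq> H"
    using F1 F2 P H by (auto simp: F_def m_def intro!: subgroup.m_closed)
  moreover have "finite F" "F \<noteq> {}" using F1 F2 by (auto simp: F_def)
  ultimately show "\<exists>F. finite F \<and> F \<noteq> {} \<and> F \<subseteq> H \<and>
        (\<forall>x\<in>F. \<forall>y\<in>F. inv x \<otimes> y \<in> N \<longrightarrow> x = y) \<and>
        (\<forall>k\<in>K. real (card {x \<in> F. \<forall>y\<in>F. inv y \<otimes> (k \<otimes> x) \<notin> N}) \<le> \<epsilon> * real (card F))"
    using bad by (intro exI[of _ F]) simp
qed

text \<open>An average over the fibres of \<open>c\<close>: if each of the few sets \<open>B k\<close> is a small part of \<open>F\<close>, then on some
  fibre all of them are small simultaneously. The factor \<open>card K\<close> pays for the simultaneity.\<close>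

lemma exists_fibre_with_small_intersections:
  fixes \<epsilon> \<delta> :: real
  assumes F: "finite F" "F \<noteq> {}" and K: "finite K" "real (card K) * \<delta> \<le> \<epsilon>"
    and B: "\<And>k. k \<in> K \<Longrightarrow> B k \<subseteq> F" "\<And>k. k \<in> K \<Longrightarrow> real (card (B k)) \<le> \<delta> * real (card F)"
  shows "\<exists>v\<in>c ` F. \<forall>k\<in>K. real (card {x \<in> B k. c x = v}) \<le> \<epsilon> * real (card {x \<in> F. c x = v})"
proof (rule ccontr)
  assume neg: "\<not> ?thesis"
  have fibres: "(\<Sum>v\<in>c ` F. real (card {x \<in> S. c x = v})) = real (card S)" if "S \<subseteq> F" for S
  proof -
    have fS: "finite S" using that F finite_subset by blast
    have "card S = (\<Sum>v\<in>c ` F. \<Sum>x\<in>{x \<in> S. c x = v}. 1)"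
      using sum.group[of S "c ` F" c "\<lambda>_. 1 :: nat"] fS F image_mono[OF that, of c] by simp
    then show ?thesis by simp
  qed
  have "\<epsilon> * real (card F) = (\<Sum>v\<in>c ` F. \<epsilon> * real (card {x \<in> F. c x = v}))"
    using fibres[OF order_refl] by (simp flip: sum_distrib_left)
  also have "\<dots> < (\<Sum>v\<in>c ` F. \<Sum>k\<in>K. real (card {x \<in> B k. c x = v}))"
  proof (rule sum_strict_mono)
    fix v assume "v \<in> c ` F"
    then obtain k where k: "k \<in> K" "\<epsilon> * real (card {x \<in> F. c x = v}) < real (card {x \<in> B k. c x = v})"
      using neg by (auto simp: not_le)
    note k(2)
    also have "real (card {x \<in> B k. c x = v}) \<le> (\<Sum>k\<in>K. real (card {x \<in> B k. c x = v}))"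
      using k(1) K by (intro member_le_sum) auto
    finally show "\<epsilon> * real (card {x \<in> F. c x = v}) < (\<Sum>k\<in>K. real (card {x \<in> B k. c x = v}))" .
  qed (use F in auto)
  also have "\<dots> = (\<Sum>k\<in>K. real (card (B k)))"
    by (subst sum.swap) (simp add: fibres B(1))
  also have "\<dots> \<le> (\<Sum>k\<in>K. \<delta> * real (card F))" by (intro sum_mono B(2))
  also have "\<dots> \<le> \<epsilon> * real (card F)"
    using mult_right_mono[OF K(2), of "real (card F)"] by (simp add: mult.assoc)
  finally show False by simp
qed

text \<open>This is closure under subgroups, phrased for a homomorphism. The image of \<open>T\<close> acts on \<open>\<Gamma>\<close> within its
  right cosets, so some coset meets the almost invariant set of \<open>\<Gamma>\<close> in an almost invariant part.
  Translating this part into the image and lifting it to \<open>T\<close> gives the required set.\<close>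

lemma (in group) folner_mod_kernel:
  fixes \<Gamma> :: "('c, 'd) monoid_scheme"
  assumes T: "subgroup T G" and \<Gamma>: "group \<Gamma>" "folner_group \<Gamma>"
    and \<theta>: "\<And>s. s \<in> T \<Longrightarrow> \<theta> s \<in> carrier \<Gamma>"
      "\<And>s t. s \<in> T \<Longrightarrow> t \<in> T \<Longrightarrow> \<theta> (s \<otimes> t) = \<theta> s \<otimes>\<^bsub>\<Gamma>\<^esub> \<theta> t"
  shows "folner_mod G T {t \<in> T. \<theta> t = \<one>\<^bsub>\<Gamma>\<^esub>}"
  unfolding folner_mod_def
proof (intro allI impI)
  interpret \<Gamma>: group \<Gamma> by fact
  interpret T: group "G\<lparr>carrier := T\<rparr>" using T by (rule subgroup_imp_group)
  interpret \<theta>: group_hom "G\<lparr>carrier := T\<rparr>" \<Gamma> \<theta>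
    using \<theta> by unfold_locales (auto simp: hom_def)
  have \<theta>_inv: "\<theta> (inv s) = inv\<^bsub>\<Gamma>\<^esub> \<theta> s" if "s \<in> T" for s
    using \<theta>.hom_inv[of s] m_inv_consistent[OF T that] that by simp
  have inv_T: "inv s \<in> T" if "s \<in> T" for s using subgroup.m_inv_closed[OF T that] .
  have mult_T: "s \<otimes> t \<in> T" if "s \<in> T" "t \<in> T" for s t using subgroup.m_closed[OF T that] .
  have img: "subgroup (\<theta> ` T) \<Gamma>" using \<theta>.img_is_subgroup by simp
  fix K and \<epsilon> :: real assume K: "finite K" "K \<subseteq> T" and \<epsilon>: "\<epsilon> > 0"
  define \<delta> where "\<delta> = \<epsilon> / (real (card (\<theta> ` K)) + 1)"
  have \<delta>: "\<delta> > 0" "real (card (\<theta> ` K)) * \<delta> \<le> \<epsilon>" using \<epsilon> by (auto simp: \<delta>_def field_simps)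
  have \<theta>K: "finite (\<theta> ` K)" "\<theta> ` K \<subseteq> carrier \<Gamma>" using K \<theta>(1) by auto
  obtain F where F: "finite F" "F \<noteq> {}" "F \<subseteq> carrier \<Gamma>" and
    bad: "\<And>k. k \<in> \<theta> ` K \<Longrightarrow> real (card {x \<in> F. k \<otimes>\<^bsub>\<Gamma>\<^esub> x \<notin> F}) \<le> \<delta> * real (card F)"
    using folner_groupE[OF \<Gamma>(2) \<theta>K \<delta>(1)] by blast
  let ?c = "\<lambda>y. \<theta> ` T #>\<^bsub>\<Gamma>\<^esub> y"
  have "\<exists>v\<in>?c ` F. \<forall>k\<in>\<theta> ` K.
      real (card {x \<in> {x \<in> F. k \<otimes>\<^bsub>\<Gamma>\<^esub> x \<notin> F}. ?c x = v}) \<le> \<epsilon> * real (card {x \<in> F. ?c x = v})"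
    by (rule exists_fibre_with_small_intersections[where \<delta> = \<delta>]) (use F K \<delta> bad in auto)
  then obtain v where v: "v \<in> ?c ` F" and small: "\<And>k. k \<in> \<theta> ` K \<Longrightarrow>
      real (card {x \<in> {x \<in> F. k \<otimes>\<^bsub>\<Gamma>\<^esub> x \<notin> F}. ?c x = v}) \<le> \<epsilon> * real (card {x \<in> F. ?c x = v})"
    by blast
  define E where "E = {x \<in> F. ?c x = v}"
  have EG: "x \<in> carrier \<Gamma>" if "x \<in> E" for x using that F by (auto simp: E_def)
  obtain y where y: "y \<in> E" using v by (auto simp: E_def)
  have "\<exists>s\<in>T. \<theta> s = x \<otimes>\<^bsub>\<Gamma>\<^esub> inv\<^bsub>\<Gamma>\<^esub> y" if x: "x \<in> E" for x
  proof -
    have "x \<in> ?c y" using x y \<Gamma>.rcos_self[OF EG[OF x] img] by (simp add: E_def)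
    then obtain s where "s \<in> T" "x = \<theta> s \<otimes>\<^bsub>\<Gamma>\<^esub> y" by (auto simp: r_coset_def)
    then show ?thesis using EG[OF y] \<theta>(1) by (intro bexI[of _ s]) (simp add: \<Gamma>.m_assoc)
  qed
  then obtain t where t: "\<And>x. x \<in> E \<Longrightarrow> t x \<in> T" "\<And>x. x \<in> E \<Longrightarrow> \<theta> (t x) = x \<otimes>\<^bsub>\<Gamma>\<^esub> inv\<^bsub>\<Gamma>\<^esub> y"
    by metis
  have inj_t: "x = x'" if "x \<in> E" "x' \<in> E" "\<theta> (t x) = \<theta> (t x')" for x x'
    using that t(2) EG y by simp
  have quot: "\<theta> (inv (t x) \<otimes> s) = \<one>\<^bsub>\<Gamma>\<^esub> \<longleftrightarrow> \<theta> s = \<theta> (t x)" if "x \<in> E" "s \<in> T" for x s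
    using that t(1) \<theta> \<theta>_inv inv_T \<Gamma>.inv_solve_left[of "\<one>\<^bsub>\<Gamma>\<^esub>" "\<theta> (t x)" "\<theta> s"]
    by (auto)
  define F' where "F' = t ` E"
  have F': "finite F'" "F' \<noteq> {}" "F' \<subseteq> T" using F y t(1) by (auto simp: F'_def E_def)
  have card': "card F' = card E"
    unfolding F'_def by (rule card_image, rule inj_onI, rule inj_t) simp_all
  have "x = z" if "x \<in> F'" "z \<in> F'" "inv x \<otimes> z \<in> {t \<in> T. \<theta> t = \<one>\<^bsub>\<Gamma>\<^esub>}" for x z
    using that quot inj_t t(1) unfolding F'_def by force
  moreover have "real (card {x \<in> F'. \<forall>z\<in>F'. inv z \<otimes> (k \<otimes> x) \<notin> {t \<in> T. \<theta> t = \<one>\<^bsub>\<Gamma>\<^esub>}}) \<le> \<epsilon> * real (card F')"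
    if k: "k \<in> K" for k
  proof -
    let ?B = "{x \<in> {x \<in> F. \<theta> k \<otimes>\<^bsub>\<Gamma>\<^esub> x \<notin> F}. ?c x = v}"
    have kT: "k \<in> T" using k K by auto
    have "{x \<in> F'. \<forall>z\<in>F'. inv z \<otimes> (k \<otimes> x) \<notin> {t \<in> T. \<theta> t = \<one>\<^bsub>\<Gamma>\<^esub>}} \<subseteq> t ` ?B"
    proof
      fix z assume z: "z \<in> {x \<in> F'. \<forall>z\<in>F'. inv z \<otimes> (k \<otimes> x) \<notin> {t \<in> T. \<theta> t = \<one>\<^bsub>\<Gamma>\<^esub>}}"
      then obtain x where x: "x \<in> E" "z = t x" by (auto simp: F'_def)
      have "\<theta> k \<otimes>\<^bsub>\<Gamma>\<^esub> x \<notin> F"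
      proof
        assume kx: "\<theta> k \<otimes>\<^bsub>\<Gamma>\<^esub> x \<in> F"
        have "?c (\<theta> k \<otimes>\<^bsub>\<Gamma>\<^esub> x) = (?c (\<theta> k)) #>\<^bsub>\<Gamma>\<^esub> x"
          using EG x kT \<theta>(1) by (intro \<Gamma>.coset_mult_assoc[symmetric]) auto
        also have "?c (\<theta> k) = \<theta> ` T"
          using \<Gamma>.coset_join2[OF _ img] kT \<theta>(1) by simp
        finally have kxE: "\<theta> k \<otimes>\<^bsub>\<Gamma>\<^esub> x \<in> E" using kx x by (simp add: E_def)
        have "\<theta> (k \<otimes> t x) = \<theta> (t (\<theta> k \<otimes>\<^bsub>\<Gamma>\<^esub> x))"
          using t kxE x kT \<theta> EG y by (simp add: \<Gamma>.m_assoc)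
        then have "\<theta> (inv (t (\<theta> k \<otimes>\<^bsub>\<Gamma>\<^esub> x)) \<otimes> (k \<otimes> t x)) = \<one>\<^bsub>\<Gamma>\<^esub>"
          using quot[OF kxE] t(1) x kT mult_T by simp
        then show False
          using z x kxE t(1) kT mult_T inv_T by (auto simp: F'_def)
      qed
      then show "z \<in> t ` ?B" using x by (auto simp: E_def)
    qed
    then have "card {x \<in> F'. \<forall>z\<in>F'. inv z \<otimes> (k \<otimes> x) \<notin> {t \<in> T. \<theta> t = \<one>\<^bsub>\<Gamma>\<^esub>}} \<le> card ?B"
      using F by (intro order_trans[OF card_mono card_image_le]) auto
    then show ?thesis using small[of "\<theta> k"] k by (simp add: card' E_def)
  qed
  ultimately show "\<exists>F. finite F \<and> F \<noteq> {} \<and> F \<subseteq> T \<and>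
        (\<forall>x\<in>F. \<forall>y\<in>F. inv x \<otimes> y \<in> {t \<in> T. \<theta> t = \<one>\<^bsub>\<Gamma>\<^esub>} \<longrightarrow> x = y) \<and>
        (\<forall>k\<in>K. real (card {x \<in> F. \<forall>y\<in>F. inv y \<otimes> (k \<otimes> x) \<notin> {t \<in> T. \<theta> t = \<one>\<^bsub>\<Gamma>\<^esub>}})
          \<le> \<epsilon> * real (card F))"
    using F' by (intro exI[of _ F']) simp
qed

section \<open>Green's relations and Schuetzenberger groups\<close>

lemma mult_J_class_of_one [simp]: "mult (J_class_of_one M) = mult M"
  by (simp add: J_class_of_one_def)

lemma one_J_class_of_one [simp]: "one (J_class_of_one M) = one M"
  by (simp add: J_class_of_one_def)

context monoid
begin

lemma green_L_iff:
  "(x, y) \<in> green_L G \<longleftrightarrow> x \<in> carrier G \<and> y \<in> carrier G \<and>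
     (\<exists>a\<in>carrier G. x = a \<otimes> y) \<and> (\<exists>b\<in>carrier G. y = b \<otimes> x)"
proof -
  have "carrier G #> x = carrier G #> y \<longleftrightarrow> (\<exists>a\<in>carrier G. x = a \<otimes> y) \<and> (\<exists>b\<in>carrier G. y = b \<otimes> x)"
    if xy: "x \<in> carrier G" "y \<in> carrier G"
  proof
    assume eq: "carrier G #> x = carrier G #> y"
    have "\<one> \<otimes> x \<in> carrier G #> x" "\<one> \<otimes> y \<in> carrier G #> y" unfolding r_coset_def by blast+
    then have "x \<in> carrier G #> y" "y \<in> carrier G #> x" using eq xy by simp_all
    then show "(\<exists>a\<in>carrier G. x = a \<otimes> y) \<and> (\<exists>b\<in>carrier G. y = b \<otimes> x)"
      by (auto simp: r_coset_def)
  next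
    have sub: "carrier G #> x \<subseteq> carrier G #> y"
      if "a \<in> carrier G" "x = a \<otimes> y" "y \<in> carrier G" for a x y
    proof
      fix u assume "u \<in> carrier G #> x"
      then obtain m where "m \<in> carrier G" "u = m \<otimes> x" by (auto simp: r_coset_def)
      then have "u = (m \<otimes> a) \<otimes> y" "m \<otimes> a \<in> carrier G" using that by (auto simp: m_assoc)
      then show "u \<in> carrier G #> y" by (auto simp: r_coset_def)
    qed
    assume "(\<exists>a\<in>carrier G. x = a \<otimes> y) \<and> (\<exists>b\<in>carrier G. y = b \<otimes> x)"
    then show "carrier G #> x = carrier G #> y" using sub xy by blast
  qed
  then show ?thesis by (auto simp: green_L_def)
qed

lemma green_R_iff:
  "(x, y) \<in> green_R G \<longleftrightarrow> x \<in> carrier G \<and> y \<in> carrier G \<and>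
     (\<exists>a\<in>carrier G. x = y \<otimes> a) \<and> (\<exists>b\<in>carrier G. y = x \<otimes> b)"
proof -
  have "x <# carrier G = y <# carrier G \<longleftrightarrow> (\<exists>a\<in>carrier G. x = y \<otimes> a) \<and> (\<exists>b\<in>carrier G. y = x \<otimes> b)"
    if xy: "x \<in> carrier G" "y \<in> carrier G"
  proof
    assume eq: "x <# carrier G = y <# carrier G"
    have "x \<otimes> \<one> \<in> x <# carrier G" "y \<otimes> \<one> \<in> y <# carrier G" unfolding l_coset_def by blast+
    then have "x \<in> y <# carrier G" "y \<in> x <# carrier G" using eq xy by simp_all
    then show "(\<exists>a\<in>carrier G. x = y \<otimes> a) \<and> (\<exists>b\<in>carrier G. y = x \<otimes> b)"
      by (auto simp: l_coset_def)
  next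
    have sub: "x <# carrier G \<subseteq> y <# carrier G"
      if "a \<in> carrier G" "x = y \<otimes> a" "y \<in> carrier G" for a x y
    proof
      fix u assume "u \<in> x <# carrier G"
      then obtain m where "m \<in> carrier G" "u = x \<otimes> m" by (auto simp: l_coset_def)
      then have "u = y \<otimes> (a \<otimes> m)" "a \<otimes> m \<in> carrier G" using that by (auto simp: m_assoc)
      then show "u \<in> y <# carrier G" by (auto simp: l_coset_def)
    qed
    assume "(\<exists>a\<in>carrier G. x = y \<otimes> a) \<and> (\<exists>b\<in>carrier G. y = x \<otimes> b)"
    then show "x <# carrier G = y <# carrier G" using sub xy by blast
  qed
  then show ?thesis by (auto simp: green_R_def)
qed

lemma equiv_green_L: "equiv (carrier G) (green_L G)"
  by (auto simp: green_L_def equiv_def refl_on_def sym_on_def trans_on_def)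

lemma equiv_green_H: "equiv (carrier G) (green_H G)"
  by (auto simp: green_H_def green_L_def green_R_def equiv_def refl_on_def sym_on_def trans_on_def)

lemma green_L_sym: "(x, y) \<in> green_L G \<Longrightarrow> (y, x) \<in> green_L G"
  by (simp add: green_L_def)

lemma green_L_trans: "(x, y) \<in> green_L G \<Longrightarrow> (y, z) \<in> green_L G \<Longrightarrow> (x, z) \<in> green_L G"
  by (simp add: green_L_def)

lemma green_R_sym: "(x, y) \<in> green_R G \<Longrightarrow> (y, x) \<in> green_R G"
  by (simp add: green_R_def)

lemma green_R_trans: "(x, y) \<in> green_R G \<Longrightarrow> (y, z) \<in> green_R G \<Longrightarrow> (x, z) \<in> green_R G"
  by (simp add: green_R_def)

lemma green_L_mult_right:
  assumes "(x, y) \<in> green_L G" "g \<in> carrier G"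
  shows "(x \<otimes> g, y \<otimes> g) \<in> green_L G"
  using assms unfolding green_L_iff by (metis m_assoc m_closed)

lemma carrier_J_class_of_one_iff:
  "x \<in> carrier (J_class_of_one G) \<longleftrightarrow>
     x \<in> carrier G \<and> (\<exists>a\<in>carrier G. \<exists>b\<in>carrier G. a \<otimes> x \<otimes> b = \<one>)"
proof -
  have ideal: "carrier G #> x <#> carrier G = (\<Union>a\<in>carrier G. \<Union>b\<in>carrier G. {a \<otimes> x \<otimes> b})" for x
    by (auto simp: set_mult_def r_coset_def)
  have whole: "carrier G #> \<one> <#> carrier G = carrier G"
    unfolding ideal by (auto intro!: bexI[of _ \<one>])
  have "carrier G = carrier G #> x <#> carrier G \<longleftrightarrow> (\<exists>a\<in>carrier G. \<exists>b\<in>carrier G. a \<otimes> x \<otimes> b = \<one>)"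
    if x: "x \<in> carrier G"
  proof
    assume "carrier G = carrier G #> x <#> carrier G"
    then have "\<one> \<in> carrier G #> x <#> carrier G" by (metis one_closed)
    then obtain a b where "a \<in> carrier G" "b \<in> carrier G" "\<one> = a \<otimes> x \<otimes> b" unfolding ideal by blast
    then show "\<exists>a\<in>carrier G. \<exists>b\<in>carrier G. a \<otimes> x \<otimes> b = \<one>" by metis
  next
    assume "\<exists>a\<in>carrier G. \<exists>b\<in>carrier G. a \<otimes> x \<otimes> b = \<one>"
    then obtain a b where ab: "a \<in> carrier G" "b \<in> carrier G" "a \<otimes> x \<otimes> b = \<one>" by blast
    show "carrier G = carrier G #> x <#> carrier G"
    proof
      show "carrier G \<subseteq> carrier G #> x <#> carrier G"
      proof
        fix y assume y: "y \<in> carrier G"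
        have "y = (y \<otimes> a) \<otimes> x \<otimes> b" using y ab x by (simp add: m_assoc)
        then show "y \<in> carrier G #> x <#> carrier G" unfolding ideal using ab y by blast
      qed
      show "carrier G #> x <#> carrier G \<subseteq> carrier G" unfolding ideal using x by auto
    qed
  qed
  then show ?thesis by (auto simp: J_class_of_one_def green_J_def whole)
qed

lemma factor_of_unit_is_unit:
  assumes "x \<in> carrier G" "y \<in> carrier G" "x \<otimes> y \<in> carrier (J_class_of_one G)"
  shows "x \<in> carrier (J_class_of_one G)" "y \<in> carrier (J_class_of_one G)"
proof -
  obtain a b where ab: "a \<in> carrier G" "b \<in> carrier G" "a \<otimes> (x \<otimes> y) \<otimes> b = \<one>"
    using assms(3) by (auto simp: carrier_J_class_of_one_iff)
  have "a \<otimes> x \<otimes> (y \<otimes> b) = \<one>" "(a \<otimes> x) \<otimes> y \<otimes> b = \<one>" using ab assms by (auto simp: m_assoc)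
  then show "x \<in> carrier (J_class_of_one G)" "y \<in> carrier (J_class_of_one G)"
    using ab assms unfolding carrier_J_class_of_one_iff by (meson m_closed)+
qed

text \<open>The inverse of right multiplication by \<open>m\<close> on \<open>H\<close> is again a right multiplication: any \<open>n\<close> with \<open>h0 m n = h0\<close>
  undoes \<open>m\<close> on all of \<open>H\<close>, because \<open>H\<close> is contained in \<open>M h0\<close>.\<close>

lemma schutzenberger_group_is_group:
  assumes H: "H \<in> carrier G // green_H G"
  shows "group (schutzenberger_group G H)"
proof -
  obtain h0 where h0: "h0 \<in> carrier G" "H = green_H G `` {h0}" using H by (blast elim: quotientE)
  have HG: "h \<in> carrier G" if "h \<in> H" for h using that h0 by (auto simp: green_H_def green_L_def)
  have h0H: "h0 \<in> H" using h0 equiv_green_H by (auto simp: equiv_def refl_on_def)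
  have HL: "\<exists>u\<in>carrier G. h = u \<otimes> h0" if "h \<in> H" for h
    using that h0 by (auto simp: green_H_def green_L_iff)
  have HR: "(h0, h) \<in> green_R G" if "h \<in> H" for h using that h0 by (auto simp: green_H_def)
  show ?thesis
  proof (rule groupI)
    fix \<sigma> \<tau> assume \<sigma>: "\<sigma> \<in> carrier (schutzenberger_group G H)"
      and \<tau>: "\<tau> \<in> carrier (schutzenberger_group G H)"
    then obtain m n where "m \<in> carrier G" "\<forall>h\<in>H. \<sigma> h = h \<otimes> m" "n \<in> carrier G" "\<forall>h\<in>H. \<tau> h = h \<otimes> n"
      by (auto simp: schutzenberger_group_def)
    moreover have "compose H \<tau> \<sigma> \<in> Bij H" "\<sigma> ` H \<subseteq> H"
      using \<sigma> \<tau>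
      by (auto simp: schutzenberger_group_def right_sym_group_def compose_Bij dest: Bij_imp_funcset)
    ultimately show "\<sigma> \<otimes>\<^bsub>schutzenberger_group G H\<^esub> \<tau> \<in> carrier (schutzenberger_group G H)"
      using HG by (auto simp: schutzenberger_group_def right_sym_group_def compose_def m_assoc
          image_subset_iff intro!: bexI[of _ "m \<otimes> n"])
  next
    show "\<one>\<^bsub>schutzenberger_group G H\<^esub> \<in> carrier (schutzenberger_group G H)"
      using HG by (auto simp: schutzenberger_group_def right_sym_group_def id_Bij intro!: bexI[of _ \<one>])
  next
    fix \<sigma> \<tau> \<rho>
    assume "\<sigma> \<in> carrier (schutzenberger_group G H)" "\<tau> \<in> carrier (schutzenberger_group G H)"
      "\<rho> \<in> carrier (schutzenberger_group G H)"
    then show "\<sigma> \<otimes>\<^bsub>schutzenberger_group G H\<^esub> \<tau> \<otimes>\<^bsub>schutzenberger_group G H\<^esub> \<rho> =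
        \<sigma> \<otimes>\<^bsub>schutzenberger_group G H\<^esub> (\<tau> \<otimes>\<^bsub>schutzenberger_group G H\<^esub> \<rho>)"
      by (auto simp: schutzenberger_group_def right_sym_group_def compose_def fun_eq_iff Bij_def
          bij_betw_def)
  next
    fix \<sigma> assume "\<sigma> \<in> carrier (schutzenberger_group G H)"
    then show "\<one>\<^bsub>schutzenberger_group G H\<^esub> \<otimes>\<^bsub>schutzenberger_group G H\<^esub> \<sigma> = \<sigma>"
      by (auto simp: schutzenberger_group_def right_sym_group_def compose_def fun_eq_iff Bij_def
          extensional_def)
  next
    fix \<sigma> assume \<sigma>: "\<sigma> \<in> carrier (schutzenberger_group G H)"
    then obtain m where m: "m \<in> carrier G" "\<And>h. h \<in> H \<Longrightarrow> \<sigma> h = h \<otimes> m"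
      and bij: "\<sigma> \<in> Bij H" by (auto simp: schutzenberger_group_def right_sym_group_def)
    have img: "\<sigma> ` H = H" using bij by (auto simp: Bij_def bij_betw_def)
    have "(h0, \<sigma> h0) \<in> green_R G" using HR img h0H by blast
    then obtain n where n: "n \<in> carrier G" "h0 = (h0 \<otimes> m) \<otimes> n" using m h0H by (auto simp: green_R_iff)
    have undo: "h \<otimes> m \<otimes> n = h" if "h \<in> H" for h
    proof -
      obtain u where "u \<in> carrier G" "h = u \<otimes> h0" using HL \<open>h \<in> H\<close> by blast
      then show ?thesis using n m h0 by (metis m_assoc m_closed)
    qed
    define \<tau> where "\<tau> = (\<lambda>h\<in>H. h \<otimes> n)"
    have left: "\<tau> (\<sigma> h) = h" if "h \<in> H" for h
      using that img m(2) undo by (auto simp: \<tau>_def)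
    have "\<tau> ` H = H"
    proof -
      have "\<tau> ` H = \<tau> ` \<sigma> ` H" using img by simp
      also have "\<dots> = H" using left by (simp add: image_image)
      finally show ?thesis .
    qed
    moreover have "inj_on \<tau> H"
    proof (rule inj_onI)
      fix a b assume ab: "a \<in> H" "b \<in> H" "\<tau> a = \<tau> b"
      then have "a \<in> \<sigma> ` H" "b \<in> \<sigma> ` H" using img by simp_all
      then obtain c d where "c \<in> H" "d \<in> H" "a = \<sigma> c" "b = \<sigma> d" by blast
      then show "a = b" using ab left by simp
    qed
    ultimately have "\<tau> \<in> carrier (schutzenberger_group G H)"
      using n(1) by (auto simp: schutzenberger_group_def right_sym_group_def Bij_def bij_betw_def \<tau>_def)
    moreover have "\<sigma> (\<tau> h) = h" if h: "h \<in> H" for h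
    proof -
      obtain c where c: "c \<in> H" "h = \<sigma> c" using img h by blast
      then show ?thesis using left by simp
    qed
    then have "\<tau> \<otimes>\<^bsub>schutzenberger_group G H\<^esub> \<sigma> = \<one>\<^bsub>schutzenberger_group G H\<^esub>"
      by (auto simp: schutzenberger_group_def right_sym_group_def compose_def fun_eq_iff)
    ultimately show "\<exists>\<tau>\<in>carrier (schutzenberger_group G H).
        \<tau> \<otimes>\<^bsub>schutzenberger_group G H\<^esub> \<sigma> = \<one>\<^bsub>schutzenberger_group G H\<^esub>" by blast
  qed
qed

text \<open>Let \<open>z = h0 v\<close> and \<open>h0 = z w\<close>. By Green's lemma, right multiplication by \<open>v\<close> carries \<open>H\<close> to the \<open>\<H>\<close>-class of
  \<open>z\<close> with inverse \<open>w\<close>, and left multiplication carries that class to the one of \<open>x\<close> and commutes with the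
  action of \<open>P\<close> on the right. Hence \<open>P\<close> acts on \<open>H\<close> by \<open>h \<mapsto> h v p w\<close>, and \<open>p\<close> fixes \<open>x\<close> if and only if it fixes \<open>z\<close>, if
  and only if it acts trivially on \<open>H\<close>. It is enough to assume that \<open>P\<close> fixes the \<open>\<L>\<close>-class of \<open>x\<close>, since
  multiplying by units never leaves an \<open>\<R>\<close>-class.\<close>

lemma hom_to_schutzenberger_group:
  assumes group: "group (J_class_of_one G)"
    and H: "H \<in> carrier G // green_H G" "h0 \<in> H"
    and z: "(x, z) \<in> green_L G" "(z, h0) \<in> green_R G"
    and P: "subgroup P (J_class_of_one G)" "\<And>p. p \<in> P \<Longrightarrow> (x \<otimes> p, x) \<in> green_L G"
  shows "\<exists>\<theta>. (\<forall>p\<in>P. \<theta> p \<in> carrier (schutzenberger_group G H)) \<and>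
    (\<forall>p\<in>P. \<forall>q\<in>P. \<theta> (p \<otimes> q) = \<theta> p \<otimes>\<^bsub>schutzenberger_group G H\<^esub> \<theta> q) \<and>
    (\<forall>p\<in>P. \<theta> p = \<one>\<^bsub>schutzenberger_group G H\<^esub> \<longleftrightarrow> x \<otimes> p = x)"
proof -
  interpret U: group "J_class_of_one G" by fact
  have PG: "p \<in> carrier G" if "p \<in> P" for p
    using that subgroup.mem_carrier[OF P(1)] by (auto simp: carrier_J_class_of_one_iff)
  have Pinv: "\<exists>p'\<in>P. p \<otimes> p' = \<one> \<and> p' \<otimes> p = \<one>" if "p \<in> P" for p
    using subgroup.m_inv_closed[OF P(1) that] U.r_inv U.l_inv subgroup.mem_carrier[OF P(1) that] by auto
  have Pmult: "p \<otimes> q \<in> P" if "p \<in> P" "q \<in> P" for p q using subgroup.m_closed[OF P(1) that] by simp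
  have H_eq: "H = green_H G `` {h0}"
    using H equiv_green_H by (metis Image_singleton_iff equiv_class_eq quotientE)
  have h0: "h0 \<in> carrier G" and x: "x \<in> carrier G" and zG: "z \<in> carrier G"
    using z by (auto simp: green_L_iff green_R_iff)
  have memH: "h \<in> H \<longleftrightarrow> (h0, h) \<in> green_L G \<and> (h0, h) \<in> green_R G" for h
    unfolding H_eq by (auto simp: green_H_def)
  obtain v w where vw: "v \<in> carrier G" "w \<in> carrier G" "z = h0 \<otimes> v" "h0 = z \<otimes> w"
    using z by (auto simp: green_R_iff)
  obtain s t where st: "s \<in> carrier G" "t \<in> carrier G" "x = t \<otimes> z" "z = s \<otimes> x"
    using z by (auto simp: green_L_iff)
  have zp: "\<exists>r\<in>carrier G. z \<otimes> p = r \<otimes> z" if p: "p \<in> P" for p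
  proof -
    obtain q where q: "q \<in> carrier G" "x \<otimes> p = q \<otimes> x" using P(2)[OF p] by (auto simp: green_L_iff)
    have "z \<otimes> p = s \<otimes> (x \<otimes> p)" using st(4) st(1) x PG[OF p] by (metis m_assoc)
    also have "\<dots> = s \<otimes> (q \<otimes> (t \<otimes> z))" by (simp only: q(2) st(3)[symmetric])
    also have "\<dots> = (s \<otimes> q \<otimes> t) \<otimes> z" using q(1) st(1,2) zG by (simp add: m_assoc)
    finally show ?thesis using q st by blast
  qed
  have zwv: "z \<otimes> w \<otimes> v = z" using vw by simp
  \<comment> \<open>\<open>w\<close> and \<open>v\<close> cancel on the whole left ideal generated by \<open>z\<close>, where all products below stay\<close>
  have restore: "y \<otimes> w \<otimes> v = y" if "r \<in> carrier G" "y = r \<otimes> z" for r y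
    using that zwv vw(1,2) zG by (metis m_assoc m_closed)
  define f where "f p h = h \<otimes> v \<otimes> p \<otimes> w" for p h
  have hv: "\<exists>u\<in>carrier G. h = u \<otimes> h0 \<and> h \<otimes> v = u \<otimes> z" if h: "h \<in> H" for h
  proof -
    obtain u where "u \<in> carrier G" "h = u \<otimes> h0" using h memH by (auto simp: green_L_iff)
    then show ?thesis using vw h0 by (metis m_assoc)
  qed
  have HG: "h \<in> carrier G" if "h \<in> H" for h using that memH by (auto simp: green_L_iff)
  have hvp: "\<exists>r\<in>carrier G. h \<otimes> v \<otimes> p = r \<otimes> z" if h: "h \<in> H" and p: "p \<in> P" for h p
  proof -
    obtain u r where "u \<in> carrier G" "h \<otimes> v = u \<otimes> z" "r \<in> carrier G" "z \<otimes> p = r \<otimes> z"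
      using hv[OF h] zp[OF p] by blast
    then show ?thesis using PG[OF p] zG by (metis m_assoc m_closed)
  qed
  have f_mult: "f q (f p h) = f (p \<otimes> q) h" if h: "h \<in> H" and pq: "p \<in> P" "q \<in> P" for p q h
  proof -
    obtain r where r: "r \<in> carrier G" "h \<otimes> v \<otimes> p = r \<otimes> z" using hvp h pq by blast
    have "f q (f p h) = (h \<otimes> v \<otimes> p \<otimes> w \<otimes> v) \<otimes> q \<otimes> w" by (simp add: f_def)
    also have "h \<otimes> v \<otimes> p \<otimes> w \<otimes> v = h \<otimes> v \<otimes> p" using restore[OF r] .
    finally show ?thesis using HG[OF h] PG pq vw(1,2) by (simp add: f_def m_assoc)
  qed
  have f_id: "f p h = h" if h: "h \<in> H" and p: "p \<in> P" "z \<otimes> p = z" for p h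
  proof -
    obtain u where u: "u \<in> carrier G" "h = u \<otimes> h0" "h \<otimes> v = u \<otimes> z" using hv[OF h] by blast
    have "f p h = u \<otimes> ((z \<otimes> p) \<otimes> w)" using u zG PG[OF p(1)] vw(2) by (simp add: f_def m_assoc)
    also have "\<dots> = h" using p(2) vw(4) u(2) by simp
    finally show ?thesis .
  qed
  have oneP: "\<one> \<in> P" using subgroup.one_closed[OF P(1)] by simp
  have f_one: "f \<one> h = h" if "h \<in> H" for h using f_id[OF that oneP] zG by simp
  have fH: "f p h \<in> H" if h: "h \<in> H" and p: "p \<in> P" for p h
  proof -
    obtain p' where p': "p' \<in> P" "p \<otimes> p' = \<one>" "p' \<otimes> p = \<one>" using Pinv p by blast
    note G = HG[OF h] PG[OF p] PG[OF p'(1)] vw(1,2) h0 zG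
    have fG: "f p h \<in> carrier G" using G by (simp add: f_def)
    have "h = f p' (f p h)" using f_mult[OF h p p'(1)] p' f_one[OF h] by simp
    then have "h = f p h \<otimes> (v \<otimes> p' \<otimes> w)" using G fG by (simp add: f_def[of p'] m_assoc)
    moreover have "f p h = h \<otimes> (v \<otimes> p \<otimes> w)" using G by (simp add: f_def m_assoc)
    ultimately have "(h, f p h) \<in> green_R G" using G fG unfolding green_R_iff by blast
    then have R: "(h0, f p h) \<in> green_R G" using h memH green_R_trans by blast
    obtain r where r: "r \<in> carrier G" "h \<otimes> v \<otimes> p = r \<otimes> z" using hvp h p by blast
    then have 1: "f p h = r \<otimes> h0" using vw(4) G by (metis f_def m_assoc)
    obtain r' where r': "r' \<in> carrier G" "z \<otimes> p' = r' \<otimes> z" using zp[OF p'(1)] by blast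
    obtain u' where u': "u' \<in> carrier G" "h0 = u' \<otimes> h" using h memH by (auto simp: green_L_iff)
    have "h0 = (z \<otimes> p') \<otimes> p \<otimes> w" using G vw(4) p' by (simp add: m_assoc)
    also have "\<dots> = r' \<otimes> ((u' \<otimes> h) \<otimes> v) \<otimes> p \<otimes> w" using r'(2) vw(3) u'(2) by simp
    also have "\<dots> = (r' \<otimes> u') \<otimes> f p h" using r'(1) u'(1) G by (simp add: f_def m_assoc)
    finally have "(h0, f p h) \<in> green_L G"
      using 1 r(1) r'(1) u'(1) h0 fG unfolding green_L_iff by blast
    then show ?thesis using R memH by blast
  qed
  define \<theta> where "\<theta> p = (\<lambda>h\<in>H. f p h)" for p
  have "\<theta> p \<in> carrier (schutzenberger_group G H)" if p: "p \<in> P" for p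
  proof -
    obtain p' where p': "p' \<in> P" "p \<otimes> p' = \<one>" "p' \<otimes> p = \<one>" using Pinv p by blast
    have "bij_betw (\<theta> p) H H"
      by (rule bij_betw_byWitness[where f' = "f p'"])
        (use fH f_mult f_one p p' in \<open>auto simp: \<theta>_def\<close>)
    moreover have "\<forall>h\<in>H. \<theta> p h = h \<otimes> (v \<otimes> p \<otimes> w)"
      using HG PG[OF p] vw(1,2) by (auto simp: \<theta>_def f_def m_assoc)
    ultimately show ?thesis
      using PG[OF p] vw(1,2)
      by (auto simp: schutzenberger_group_def right_sym_group_def Bij_def \<theta>_def)
  qed
  moreover have "\<theta> (p \<otimes> q) = \<theta> p \<otimes>\<^bsub>schutzenberger_group G H\<^esub> \<theta> q" if "p \<in> P" "q \<in> P" for p q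
    using that fH f_mult
    by (auto simp: schutzenberger_group_def right_sym_group_def compose_def \<theta>_def fun_eq_iff)
  moreover have "\<theta> p = \<one>\<^bsub>schutzenberger_group G H\<^esub> \<longleftrightarrow> x \<otimes> p = x" if p: "p \<in> P" for p
  proof
    assume "\<theta> p = \<one>\<^bsub>schutzenberger_group G H\<^esub>"
    then have "\<theta> p h0 = \<one>\<^bsub>schutzenberger_group G H\<^esub> h0" by simp
    then have "f p h0 = h0"
      using H(2) by (simp add: schutzenberger_group_def right_sym_group_def \<theta>_def)
    then have zpw: "z \<otimes> p \<otimes> w = h0" using vw(3) by (simp add: f_def)
    obtain r where "r \<in> carrier G" "z \<otimes> p = r \<otimes> z" using zp[OF p] by blast
    then have "z \<otimes> p = z" using restore zpw vw(3) by metis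
    then show "x \<otimes> p = x" using st(2,3) zG PG[OF p] by (metis m_assoc)
  next
    assume "x \<otimes> p = x"
    then have "z \<otimes> p = z" using st(1,4) x PG[OF p] by (metis m_assoc)
    then show "\<theta> p = \<one>\<^bsub>schutzenberger_group G H\<^esub>"
      using f_id p by (auto simp: schutzenberger_group_def right_sym_group_def \<theta>_def fun_eq_iff)
  qed
  ultimately show ?thesis by blast
qed

end

section \<open>Units acting on the right of a non-unit\<close>

context monoid
begin

abbreviation \<U> where "\<U> \<equiv> J_class_of_one G"

definition right_fixer :: "'a \<Rightarrow> 'a set" where
  "right_fixer k = {g \<in> carrier \<U>. \<forall>x\<in>carrier \<U>. k \<otimes> x \<otimes> g = k \<otimes> x}"

text \<open>The kernel of the \<open>\<circ>\<close>-action on the orbit of the \<open>\<H>\<close>-class of \<open>k\<close>. Only the relation \<open>\<L>\<close> is mentioned since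
  units preserve \<open>\<R>\<close>-classes anyway.\<close>

definition class_fixer :: "'a \<Rightarrow> 'a set" where
  "class_fixer k = {g \<in> carrier \<U>. \<forall>x\<in>carrier \<U>. (k \<otimes> x \<otimes> g, k \<otimes> x) \<in> green_L G}"

lemma unit_closed: "g \<in> carrier \<U> \<Longrightarrow> g \<in> carrier G"
  by (simp add: carrier_J_class_of_one_iff)

lemma green_R_mult_unit:
  assumes U: "group \<U>" and "m \<in> carrier G" "g \<in> carrier \<U>"
  shows "(m \<otimes> g, m) \<in> green_R G"
proof -
  interpret U: group \<U> by fact
  have "inv\<^bsub>\<U>\<^esub> g \<in> carrier G" "g \<in> carrier G" using assms by (auto intro: unit_closed)
  moreover have "g \<otimes> inv\<^bsub>\<U>\<^esub> g = \<one>" using U.r_inv assms by simp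
  then have "m = m \<otimes> g \<otimes> inv\<^bsub>\<U>\<^esub> g" using assms calculation by (simp add: m_assoc)
  ultimately show ?thesis using assms(2) unfolding green_R_iff by (metis m_closed)
qed

lemma green_H_mult_unit_iff:
  assumes U: "group \<U>" and k: "k \<in> carrier G" and x: "x \<in> carrier \<U>" and g: "g \<in> carrier \<U>"
  shows "(k \<otimes> x \<otimes> g, k \<otimes> x) \<in> green_H G \<longleftrightarrow> (k \<otimes> x \<otimes> g, k \<otimes> x) \<in> green_L G"
  using green_R_mult_unit[OF U _ g, of "k \<otimes> x"] k unit_closed[OF x] by (simp add: green_H_def)

lemma subgroup_unitsI:
  assumes U: "group \<U>" and "S \<subseteq> carrier \<U>" "\<one> \<in> S"
    and "\<And>g h. g \<in> S \<Longrightarrow> h \<in> S \<Longrightarrow> g \<otimes> h \<in> S"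
    and "\<And>g. g \<in> S \<Longrightarrow> inv\<^bsub>\<U>\<^esub> g \<in> S"
  shows "subgroup S \<U>"
  using assms by (intro group.subgroupI[OF U]) auto

lemma subgroup_fixer_on:
  assumes U: "group \<U>" and k: "k \<in> carrier G" and T: "subgroup T \<U>" and J: "J \<subseteq> carrier \<U>"
  shows "subgroup {g \<in> T. \<forall>x\<in>J. k \<otimes> x \<otimes> g = k \<otimes> x} \<U>"
proof (rule subgroup_unitsI[OF U])
  interpret U: group \<U> by fact
  have TG: "g \<in> carrier G" "g \<in> carrier \<U>" if "g \<in> T" for g
    using unit_closed subgroup.mem_carrier[OF T that] by auto
  have JG: "x \<in> carrier G" if "x \<in> J" for x using that J unit_closed by auto
  show "{g \<in> T. \<forall>x\<in>J. k \<otimes> x \<otimes> g = k \<otimes> x} \<subseteq> carrier \<U>" using TG by auto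
  show "\<one> \<in> {g \<in> T. \<forall>x\<in>J. k \<otimes> x \<otimes> g = k \<otimes> x}"
    using subgroup.one_closed[OF T] k JG by simp
  fix g assume g: "g \<in> {g \<in> T. \<forall>x\<in>J. k \<otimes> x \<otimes> g = k \<otimes> x}"
  show "inv\<^bsub>\<U>\<^esub> g \<in> {g \<in> T. \<forall>x\<in>J. k \<otimes> x \<otimes> g = k \<otimes> x}"
  proof -
    have gT: "g \<in> T" using g by simp
    have i: "inv\<^bsub>\<U>\<^esub> g \<in> T" using subgroup.m_inv_closed[OF T gT] .
    have "g \<otimes> inv\<^bsub>\<U>\<^esub> g = \<one>" using U.r_inv TG(2)[OF gT] by simp
    have "k \<otimes> x \<otimes> inv\<^bsub>\<U>\<^esub> g = k \<otimes> x" if x: "x \<in> J" for x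
    proof -
      have "k \<otimes> x \<otimes> inv\<^bsub>\<U>\<^esub> g = (k \<otimes> x \<otimes> g) \<otimes> inv\<^bsub>\<U>\<^esub> g" using g x by simp
      also have "\<dots> = k \<otimes> x"
        using \<open>g \<otimes> inv\<^bsub>\<U>\<^esub> g = \<one>\<close> k JG[OF x] TG(1)[OF gT] TG(1)[OF i] by (simp add: m_assoc)
      finally show ?thesis .
    qed
    then show ?thesis using i by simp
  qed
  fix h assume h: "h \<in> {g \<in> T. \<forall>x\<in>J. k \<otimes> x \<otimes> g = k \<otimes> x}"
  have "k \<otimes> x \<otimes> (g \<otimes> h) = k \<otimes> x" if x: "x \<in> J" for x
  proof -
    have "k \<otimes> x \<otimes> (g \<otimes> h) = (k \<otimes> x \<otimes> g) \<otimes> h" using g h TG k JG[OF x] by (simp add: m_assoc)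
    then show ?thesis using g h x by simp
  qed
  moreover have "g \<otimes> h \<in> T" using subgroup.m_closed[OF T] g h by simp
  ultimately show "g \<otimes> h \<in> {g \<in> T. \<forall>x\<in>J. k \<otimes> x \<otimes> g = k \<otimes> x}" by simp
qed

lemma subgroup_right_fixer:
  assumes "group \<U>" "k \<in> carrier G"
  shows "subgroup (right_fixer k) \<U>"
  unfolding right_fixer_def using assms group.subgroup_self by (intro subgroup_fixer_on) auto

lemma subgroup_class_fixer:
  assumes U: "group \<U>" and k: "k \<in> carrier G"
  shows "subgroup (class_fixer k) \<U>"
proof (rule subgroup_unitsI[OF U])
  interpret U: group \<U> by fact
  show "class_fixer k \<subseteq> carrier \<U>" by (auto simp: class_fixer_def)
  show "\<one> \<in> class_fixer k"
    using U.one_closed k unit_closed by (auto simp: class_fixer_def green_L_def)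
  fix g assume g: "g \<in> class_fixer k"
  then have gU: "g \<in> carrier \<U>" by (simp add: class_fixer_def)
  have "(k \<otimes> x \<otimes> inv\<^bsub>\<U>\<^esub> g, k \<otimes> x) \<in> green_L G" if x: "x \<in> carrier \<U>" for x
  proof -
    have "(k \<otimes> x \<otimes> g, k \<otimes> x) \<in> green_L G" using g x by (simp add: class_fixer_def)
    then have "(k \<otimes> x \<otimes> g \<otimes> inv\<^bsub>\<U>\<^esub> g, k \<otimes> x \<otimes> inv\<^bsub>\<U>\<^esub> g) \<in> green_L G"
      using gU by (intro green_L_mult_right unit_closed) auto
    moreover have "k \<otimes> x \<otimes> g \<otimes> inv\<^bsub>\<U>\<^esub> g = k \<otimes> x"
      using U.r_inv[OF gU] k unit_closed[OF x] unit_closed[OF gU] unit_closed[OF U.inv_closed[OF gU]]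
      by (simp add: m_assoc)
    ultimately show ?thesis by (simp add: green_L_sym)
  qed
  then show "inv\<^bsub>\<U>\<^esub> g \<in> class_fixer k" using gU by (simp add: class_fixer_def)
  fix h assume h: "h \<in> class_fixer k"
  then have hU: "h \<in> carrier \<U>" by (simp add: class_fixer_def)
  have "(k \<otimes> x \<otimes> (g \<otimes> h), k \<otimes> x) \<in> green_L G" if x: "x \<in> carrier \<U>" for x
  proof -
    have "(k \<otimes> x \<otimes> g \<otimes> h, k \<otimes> x \<otimes> h) \<in> green_L G"
      using g x unit_closed[OF hU] by (intro green_L_mult_right) (auto simp: class_fixer_def)
    moreover have "(k \<otimes> x \<otimes> h, k \<otimes> x) \<in> green_L G" using h x by (simp add: class_fixer_def)
    ultimately show ?thesis
      using green_L_trans k unit_closed x gU hU by (metis m_assoc m_closed)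
  qed
  then show "g \<otimes> h \<in> class_fixer k" using U.m_closed[OF gU hU] by (simp add: class_fixer_def)
qed

lemma normal_class_fixer:
  assumes U: "group \<U>" and k: "k \<in> carrier G"
  shows "class_fixer k \<lhd> \<U>"
proof -
  interpret U: group \<U> by fact
  show ?thesis
    unfolding U.normal_inv_iff
  proof (intro conjI ballI subgroup_class_fixer[OF assms])
    fix a g assume a: "a \<in> carrier \<U>" and g: "g \<in> class_fixer k"
    then have gU: "g \<in> carrier \<U>" by (simp add: class_fixer_def)
    have iU: "inv\<^bsub>\<U>\<^esub> a \<in> carrier \<U>" using a by simp
    have "(k \<otimes> x \<otimes> (a \<otimes> g \<otimes> inv\<^bsub>\<U>\<^esub> a), k \<otimes> x) \<in> green_L G" if x: "x \<in> carrier \<U>" for x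
    proof -
      have "x \<otimes> a \<in> carrier \<U>" using U.m_closed[OF x a] by simp
      then have "(k \<otimes> (x \<otimes> a) \<otimes> g, k \<otimes> (x \<otimes> a)) \<in> green_L G" using g by (simp add: class_fixer_def)
      then have "(k \<otimes> (x \<otimes> a) \<otimes> g \<otimes> inv\<^bsub>\<U>\<^esub> a, k \<otimes> (x \<otimes> a) \<otimes> inv\<^bsub>\<U>\<^esub> a) \<in> green_L G"
        using unit_closed[OF iU] by (intro green_L_mult_right)
      moreover have "k \<otimes> (x \<otimes> a) \<otimes> inv\<^bsub>\<U>\<^esub> a = k \<otimes> x"
        using U.r_inv[OF a] k unit_closed[OF x] unit_closed[OF a] unit_closed[OF iU] by (simp add: m_assoc)
      moreover have "k \<otimes> (x \<otimes> a) \<otimes> g \<otimes> inv\<^bsub>\<U>\<^esub> a = k \<otimes> x \<otimes> (a \<otimes> g \<otimes> inv\<^bsub>\<U>\<^esub> a)"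
        using k unit_closed[OF x] unit_closed[OF a] unit_closed[OF iU] unit_closed[OF gU]
        by (simp add: m_assoc)
      ultimately show ?thesis by simp
    qed
    then show "a \<otimes>\<^bsub>\<U>\<^esub> g \<otimes>\<^bsub>\<U>\<^esub> inv\<^bsub>\<U>\<^esub> a \<in> class_fixer k"
      using U.m_closed[OF U.m_closed[OF a gU] iU] by (simp add: class_fixer_def)
  qed
qed

lemma right_fixer_subset_class_fixer: "k \<in> carrier G \<Longrightarrow> right_fixer k \<subseteq> class_fixer k"
  by (auto simp: right_fixer_def class_fixer_def green_L_def unit_closed)

lemma D_schutzenberger_group_eq:
  assumes k: "k \<in> carrier G"
  obtains H where "H \<in> carrier G // green_H G" "H \<subseteq> green_D G `` {k}"
    "D_schutzenberger_group G (green_D G `` {k}) = schutzenberger_group G H"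
proof -
  let ?D = "green_D G `` {k}"
  have "green_H G `` {k} \<subseteq> ?D"
    using k by (auto simp: green_H_def green_D_def green_L_def green_R_def)
  moreover have "green_H G `` {k} \<in> carrier G // green_H G" using k by (rule quotientI)
  ultimately have ex: "\<exists>H. H \<in> carrier G // green_H G \<and> H \<subseteq> ?D" by blast
  define H where "H = (SOME H. H \<in> carrier G // green_H G \<and> H \<subseteq> ?D)"
  have "H \<in> carrier G // green_H G \<and> H \<subseteq> ?D" unfolding H_def using ex by (rule someI_ex)
  moreover have "D_schutzenberger_group G ?D = schutzenberger_group G H"
    by (simp add: D_schutzenberger_group_def H_def)
  ultimately show ?thesis using that by blast
qed

lemma hom_to_D_schutzenberger_group:
  assumes U: "group \<U>" and k: "k \<in> carrier G" and x: "x \<in> carrier \<U>"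
    and P: "subgroup P \<U>" "P \<subseteq> class_fixer k"
  defines "\<Gamma> \<equiv> D_schutzenberger_group G (green_D G `` {k})"
  shows "\<exists>\<theta>. (\<forall>p\<in>P. \<theta> p \<in> carrier \<Gamma>) \<and>
    (\<forall>p\<in>P. \<forall>q\<in>P. \<theta> (p \<otimes> q) = \<theta> p \<otimes>\<^bsub>\<Gamma>\<^esub> \<theta> q) \<and>
    (\<forall>p\<in>P. \<theta> p = \<one>\<^bsub>\<Gamma>\<^esub> \<longleftrightarrow> k \<otimes> x \<otimes> p = k \<otimes> x)"
proof -
  obtain H where H: "H \<in> carrier G // green_H G" "H \<subseteq> green_D G `` {k}"
    and eq: "\<Gamma> = schutzenberger_group G H"
    unfolding \<Gamma>_def using D_schutzenberger_group_eq[OF k] by blast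
  obtain h0 where h0: "h0 \<in> H" using equiv_green_H H(1) by (metis equiv_Eps_in)
  then obtain z where z: "(k, z) \<in> green_L G" "(z, h0) \<in> green_R G" using H(2) by (auto simp: green_D_def)
  have "(k \<otimes> x, z \<otimes> x) \<in> green_L G" using z(1) unit_closed[OF x] by (rule green_L_mult_right)
  moreover have "z \<in> carrier G" using z by (simp add: green_R_iff)
  then have "(z \<otimes> x, h0) \<in> green_R G"
    using green_R_trans[OF green_R_mult_unit[OF U _ x]] z by blast
  ultimately show ?thesis
    unfolding eq
  proof (rule hom_to_schutzenberger_group[OF U H(1) h0 _ _ P(1)])
    show "(k \<otimes> x \<otimes> p, k \<otimes> x) \<in> green_L G" if "p \<in> P" for p
      using that P(2) x by (auto simp: class_fixer_def)
  qed
qed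

text \<open>An induction over \<open>J\<close> that adds one condition at a time: on the units that satisfy the earlier
  conditions, the new one is the kernel of a homomorphism to the Schuetzenberger group.\<close>

lemma folner_mod_fixer_on_finite:
  assumes U: "group \<U>" and k: "k \<in> carrier G" and T: "subgroup T \<U>" "T \<subseteq> class_fixer k"
    and \<Gamma>: "group (D_schutzenberger_group G (green_D G `` {k}))"
      "folner_group (D_schutzenberger_group G (green_D G `` {k}))"
    and J: "finite J" "J \<subseteq> carrier \<U>"
  shows "folner_mod \<U> T {g \<in> T. \<forall>x\<in>J. k \<otimes> x \<otimes> g = k \<otimes> x}"
  using J
proof (induction J)
  case empty
  show ?case
    using group.folner_mod_finite_index[OF U T(1), of T "\<lambda>_. ()"] T(1)
      subgroup.m_closed[OF T(1)] subgroup.m_inv_closed[OF T(1)] by simp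
next
  case (insert x J)
  let ?T = "{g \<in> T. \<forall>x\<in>J. k \<otimes> x \<otimes> g = k \<otimes> x}"
  let ?T' = "{g \<in> T. \<forall>x\<in>insert x J. k \<otimes> x \<otimes> g = k \<otimes> x}"
  let ?\<Gamma> = "D_schutzenberger_group G (green_D G `` {k})"
  have sT: "subgroup ?T \<U>" "subgroup ?T' \<U>"
    using insert.prems by (intro subgroup_fixer_on U k T; simp)+
  have x: "x \<in> carrier \<U>" and TP: "?T \<subseteq> class_fixer k" using insert.prems T by auto
  obtain \<theta> where \<theta>: "\<forall>p\<in>?T. \<theta> p \<in> carrier ?\<Gamma>"
    "\<forall>p\<in>?T. \<forall>q\<in>?T. \<theta> (p \<otimes> q) = \<theta> p \<otimes>\<^bsub>?\<Gamma>\<^esub> \<theta> q"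
    "\<forall>p\<in>?T. \<theta> p = \<one>\<^bsub>?\<Gamma>\<^esub> \<longleftrightarrow> k \<otimes> x \<otimes> p = k \<otimes> x"
    using hom_to_D_schutzenberger_group[OF U k x sT(1) TP] by blast
  have "folner_mod \<U> ?T {t \<in> ?T. \<theta> t = \<one>\<^bsub>?\<Gamma>\<^esub>}"
    by (rule group.folner_mod_kernel[OF U sT(1) \<Gamma>]) (use \<theta>(1,2) in auto)
  moreover have "{t \<in> ?T. \<theta> t = \<one>\<^bsub>?\<Gamma>\<^esub>} = ?T'" using \<theta>(3) by auto
  ultimately have "folner_mod \<U> ?T ?T'" by simp
  with insert.IH insert.prems show ?case
    by (intro group.folner_mod_trans[OF U T(1) sT(1) _ sT(2)]) auto
qed

text \<open>The units act on the finitely many \<open>\<L>\<close>-classes of the orbit of \<open>k\<close>, so the class fixer has finite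
  index. An element of it that fixes \<open>k x\<close> fixes the \<open>\<L>\<close>-class of \<open>k x\<close> pointwise, so it is
  enough to test one \<open>x\<close> per \<open>\<L>\<close>-class. The arbitrary subgroup \<open>Q\<close> makes the result applicable inside the fixers of
  other non-units.\<close>

lemma folner_mod_right_fixer_finite_L:
  assumes U: "group \<U>" and k: "k \<in> carrier G" and Q: "subgroup Q \<U>"
    and fin: "finite {L \<in> carrier G // green_L G. L \<subseteq> green_D G `` {k}}"
    and \<Gamma>: "group (D_schutzenberger_group G (green_D G `` {k}))"
      "folner_group (D_schutzenberger_group G (green_D G `` {k}))"
  shows "folner_mod \<U> Q (Q \<inter> right_fixer k)"
proof -
  interpret U: group \<U> by fact
  define \<L> where "\<L> = {L \<in> carrier G // green_L G. L \<subseteq> green_D G `` {k}}"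
  define cls where "cls x = green_L G `` {k \<otimes> x}" for x
  have kx: "k \<otimes> x \<in> carrier G" if "x \<in> carrier \<U>" for x using k unit_closed[OF that] by simp
  have cls_eq: "(k \<otimes> x, k \<otimes> y) \<in> green_L G" if "cls x = cls y" "x \<in> carrier \<U>" "y \<in> carrier \<U>" for x y
    using that kx eq_equiv_class[OF _ equiv_green_L] by (auto simp: cls_def)
  have cls: "cls x \<in> \<L>" if x: "x \<in> carrier \<U>" for x
  proof -
    have "y \<in> green_D G `` {k}" if y: "(k \<otimes> x, y) \<in> green_L G" for y
    proof -
      let ?i = "inv\<^bsub>\<U>\<^esub> x"
      have i: "?i \<in> carrier \<U>" using x by simp
      have "x \<otimes> ?i = \<one>" using U.r_inv x by simp
      then have "k \<otimes> x \<otimes> ?i = k" using k unit_closed[OF x] unit_closed[OF i] by (simp add: m_assoc)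
      then have "(k, y \<otimes> ?i) \<in> green_L G" using green_L_mult_right[OF y unit_closed[OF i]] by simp
      moreover have "(y \<otimes> ?i, y) \<in> green_R G"
        using y by (intro green_R_mult_unit U i) (simp add: green_L_iff)
      ultimately show ?thesis by (auto simp: green_D_def)
    qed
    then show ?thesis using kx[OF x] by (auto simp: \<L>_def cls_def intro: quotientI)
  qed
  have fin\<L>: "finite \<L>" using fin by (simp add: \<L>_def)
  have sub: "subgroup (Q \<inter> class_fixer k) \<U>"
    using Q subgroup_class_fixer[OF U k] by (rule U.subgroups_Inter_pair)
  \<comment> \<open>units acting in the same way on the finitely many classes agree modulo the class fixer\<close>
  have first: "folner_mod \<U> Q (Q \<inter> class_fixer k)"
  proof (rule U.folner_mod_finite_index[OF Q sub])
    let ?c = "\<lambda>g. (\<lambda>x. (cls x, cls (x \<otimes> g))) ` carrier \<U>"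
    have QU: "g \<in> carrier \<U>" if "g \<in> Q" for g using subgroup.mem_carrier[OF Q that] .
    have "?c ` Q \<subseteq> Pow (\<L> \<times> \<L>)"
    proof -
      have "x \<otimes> g \<in> carrier \<U>" if "g \<in> Q" "x \<in> carrier \<U>" for g x
        using U.m_closed[OF that(2) QU[OF that(1)]] by simp
      then show ?thesis using cls by auto
    qed
    then show "finite (?c ` Q)" by (rule finite_subset) (simp add: fin\<L>)
    fix g h assume gh: "g \<in> Q" "h \<in> Q" "?c g = ?c h"
    let ?i = "inv\<^bsub>\<U>\<^esub> g"
    have g: "g \<in> carrier \<U>" and h: "h \<in> carrier \<U>" and i: "?i \<in> carrier \<U>" using gh QU by auto
    note M = k unit_closed[OF g] unit_closed[OF h] unit_closed[OF i]
    have "(k \<otimes> x \<otimes> (?i \<otimes> h), k \<otimes> x) \<in> green_L G" if x: "x \<in> carrier \<U>" for x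
    proof -
      have xi: "x \<otimes> ?i \<in> carrier \<U>" using U.m_closed[OF x i] by simp
      then have "(cls (x \<otimes> ?i), cls (x \<otimes> ?i \<otimes> g)) \<in> ?c g" by blast
      then have "(cls (x \<otimes> ?i), cls (x \<otimes> ?i \<otimes> g)) \<in> ?c h" using gh(3) by simp
      then obtain y where y: "y \<in> carrier \<U>" "cls (x \<otimes> ?i) = cls y" "cls (x \<otimes> ?i \<otimes> g) = cls (y \<otimes> h)"
        by auto
      have "x \<otimes> ?i \<otimes> g = x"
        using U.l_inv[OF g] M unit_closed[OF x] by (simp add: m_assoc)
      then have "(k \<otimes> (y \<otimes> h), k \<otimes> x) \<in> green_L G"
        using cls_eq[of "y \<otimes> h" x] y x U.m_closed[OF y(1) h] by simp
      moreover have "(k \<otimes> (x \<otimes> ?i) \<otimes> h, k \<otimes> y \<otimes> h) \<in> green_L G"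
        using cls_eq[OF y(2) xi y(1)] M(3) by (rule green_L_mult_right)
      moreover have "k \<otimes> x \<otimes> (?i \<otimes> h) = k \<otimes> (x \<otimes> ?i) \<otimes> h" "k \<otimes> y \<otimes> h = k \<otimes> (y \<otimes> h)"
        using M unit_closed[OF x] unit_closed[OF y(1)] by (simp_all add: m_assoc)
      ultimately show ?thesis using green_L_trans by simp
    qed
    moreover have "?i \<otimes> h \<in> Q" using subgroup.m_closed[OF Q subgroup.m_inv_closed[OF Q gh(1)] gh(2)] by simp
    ultimately show "?i \<otimes>\<^bsub>\<U>\<^esub> h \<in> Q \<inter> class_fixer k" using QU by (simp add: class_fixer_def)
  qed
  obtain J where J: "finite J" "J \<subseteq> carrier \<U>" "cls ` carrier \<U> = cls ` J"
  proof -
    have "finite (cls ` carrier \<U>)" using cls by (intro finite_subset[OF _ fin\<L>]) auto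
    then show ?thesis using that finite_subset_image[of "cls ` carrier \<U>" cls "carrier \<U>"] by blast
  qed
  have "{g \<in> Q \<inter> class_fixer k. \<forall>x\<in>J. k \<otimes> x \<otimes> g = k \<otimes> x} = Q \<inter> right_fixer k"
  proof
    show "Q \<inter> right_fixer k \<subseteq> {g \<in> Q \<inter> class_fixer k. \<forall>x\<in>J. k \<otimes> x \<otimes> g = k \<otimes> x}"
      using right_fixer_subset_class_fixer[OF k] J by (auto simp: right_fixer_def)
    show "{g \<in> Q \<inter> class_fixer k. \<forall>x\<in>J. k \<otimes> x \<otimes> g = k \<otimes> x} \<subseteq> Q \<inter> right_fixer k"
    proof
      fix g assume g: "g \<in> {g \<in> Q \<inter> class_fixer k. \<forall>x\<in>J. k \<otimes> x \<otimes> g = k \<otimes> x}"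
      then have gU: "g \<in> carrier \<U>" by (simp add: class_fixer_def)
      have "k \<otimes> y \<otimes> g = k \<otimes> y" if y: "y \<in> carrier \<U>" for y
      proof -
        obtain x where x: "x \<in> J" "cls y = cls x" using y J(3) by blast
        then have "(k \<otimes> y, k \<otimes> x) \<in> green_L G" using cls_eq y J(2) by blast
        then obtain a where "a \<in> carrier G" "k \<otimes> y = a \<otimes> (k \<otimes> x)" by (auto simp: green_L_iff)
        moreover have "k \<otimes> x \<otimes> g = k \<otimes> x" using g x by simp
        moreover have "k \<otimes> x \<in> carrier G" using x J(2) kx by auto
        ultimately show ?thesis using unit_closed[OF gU] by (simp add: m_assoc)
      qed
      then show "g \<in> Q \<inter> right_fixer k" using g gU by (simp add: right_fixer_def)
    qed
  qed
  moreover have "folner_mod \<U> (Q \<inter> class_fixer k) {g \<in> Q \<inter> class_fixer k. \<forall>x\<in>J. k \<otimes> x \<otimes> g = k \<otimes> x}"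
    using J by (intro folner_mod_fixer_on_finite U k sub \<Gamma>) auto
  ultimately have "folner_mod \<U> (Q \<inter> class_fixer k) (Q \<inter> right_fixer k)" by simp
  moreover have "subgroup (Q \<inter> right_fixer k) \<U>"
    using Q subgroup_right_fixer[OF U k] by (rule U.subgroups_Inter_pair)
  ultimately show ?thesis
    using right_fixer_subset_class_fixer[OF k]
    by (intro U.folner_mod_trans[OF Q sub _ _ _ first]) auto
qed

lemma circ_action_class:
  assumes "x \<in> carrier G" "g \<in> carrier \<U>" and U: "group \<U>"
  shows "circ_action G g (green_H G `` {x}) = green_H G `` {x \<otimes> g}"
proof -
  have g: "g \<in> carrier G" using assms(2) by (rule unit_closed)
  have "(y \<otimes> g, x \<otimes> g) \<in> green_H G" if "(x, y) \<in> green_H G" for y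
  proof -
    have "(y, x) \<in> green_L G" "(x, y) \<in> green_R G" "y \<in> carrier G"
      using that green_L_sym by (auto simp: green_H_def green_L_def)
    moreover have "(y \<otimes> g, y) \<in> green_R G" "(x \<otimes> g, x) \<in> green_R G"
      using green_R_mult_unit[OF U _ assms(2)] assms(1) calculation by auto
    ultimately show ?thesis
      using green_L_mult_right[OF _ g] green_R_trans green_R_sym unfolding green_H_def by blast
  qed
  then have eq: "green_H G `` {y \<otimes> g} = green_H G `` {x \<otimes> g}" if "(x, y) \<in> green_H G" for y
    using that equiv_class_eq[OF equiv_green_H] by blast
  have "(x, x) \<in> green_H G" using assms(1) by (simp add: green_H_def green_L_def green_R_def)
  then have ne: "green_H G `` {x} \<noteq> {}" by blast
  have "circ_action G g (green_H G `` {x}) = (\<Union>y\<in>green_H G `` {x}. green_H G `` {y \<otimes> g})"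
    by (auto simp: circ_action_def r_coset_def)
  then have "circ_action G g (green_H G `` {x}) = (\<Union>y\<in>green_H G `` {x}. green_H G `` {x \<otimes> g})"
    using eq by simp
  then show ?thesis using ne by simp
qed

lemma pointwise_stabilizer_orbit_eq_class_fixer:
  assumes U: "group \<U>" and k: "k \<in> carrier G"
  shows "pointwise_stabilizer \<U> (circ_action G) (orbit \<U> (circ_action G) (green_H G `` {k})) = class_fixer k"
proof -
  have "circ_action G g (circ_action G x (green_H G `` {k})) = circ_action G x (green_H G `` {k}) \<longleftrightarrow>
      (k \<otimes> x \<otimes> g, k \<otimes> x) \<in> green_L G" if "g \<in> carrier \<U>" "x \<in> carrier \<U>" for g x
  proof -
    have M: "k \<otimes> x \<in> carrier G" "k \<otimes> x \<otimes> g \<in> carrier G" using k that unit_closed by auto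
    have "circ_action G g (circ_action G x (green_H G `` {k})) = green_H G `` {k \<otimes> x \<otimes> g}"
      using k that M U by (simp add: circ_action_class)
    moreover have "circ_action G x (green_H G `` {k}) = green_H G `` {k \<otimes> x}"
      using k that U by (simp add: circ_action_class)
    ultimately show ?thesis
      using eq_equiv_class_iff[OF equiv_green_H M(2,1)] green_H_mult_unit_iff[OF U k that(2,1)] by simp
  qed
  then show ?thesis
    by (auto simp: pointwise_stabilizer_def orbit_def class_fixer_def)
qed

text \<open>Local amenability handles the quotient by the class fixer. The class fixer modulo the right fixer
  embeds in a power of the Schuetzenberger group with possibly infinitely many factors; this is where
  finiteness or commutativity enters.\<close>

lemma folner_mod_right_fixer_locally_amenable:
  assumes U: "group \<U>" and k: "k \<in> carrier G" and Q: "subgroup Q \<U>"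
    and \<Gamma>: "finite (carrier (D_schutzenberger_group G (green_D G `` {k}))) \<or>
      comm_group (D_schutzenberger_group G (green_D G `` {k}))"
    and loc: "locally_amenable \<U> {H \<in> carrier G // green_H G. H \<subseteq> green_D G `` {k}} (circ_action G)"
  shows "folner_mod \<U> Q (Q \<inter> right_fixer k)"
proof -
  interpret U: group \<U> by fact
  let ?P = "class_fixer k"
  let ?\<Gamma> = "D_schutzenberger_group G (green_D G `` {k})"
  interpret P: normal ?P \<U> using normal_class_fixer[OF U k] .
  have "green_H G `` {k} \<subseteq> green_D G `` {k}"
    using k by (auto simp: green_H_def green_D_def green_L_def green_R_def)
  then have "orbit \<U> (circ_action G) (green_H G `` {k})
      \<in> orbits \<U> {H \<in> carrier G // green_H G. H \<subseteq> green_D G `` {k}} (circ_action G)"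
    using k by (auto simp: orbits_def intro: quotientI)
  then have am: "amenable_group (\<U> Mod ?P)"
    using loc pointwise_stabilizer_orbit_eq_class_fixer[OF U k] by (auto simp: locally_amenable_def)
  have QU: "g \<in> carrier \<U>" if "g \<in> Q" for g using subgroup.mem_carrier[OF Q that] .
  have sub: "subgroup (Q \<inter> ?P) \<U>"
    using Q subgroup_class_fixer[OF U k] by (rule U.subgroups_Inter_pair)
  have sub': "subgroup (Q \<inter> right_fixer k) \<U>"
    using Q subgroup_right_fixer[OF U k] by (rule U.subgroups_Inter_pair)
  have "folner_mod \<U> Q {g \<in> Q. ?P #>\<^bsub>\<U>\<^esub> g = \<one>\<^bsub>\<U> Mod ?P\<^esub>}"
  proof (rule U.folner_mod_kernel[OF Q P.factorgroup_is_group amenable_imp_folner[OF am]])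
    show "?P #>\<^bsub>\<U>\<^esub> s \<in> carrier (\<U> Mod ?P)" if "s \<in> Q" for s
      using QU[OF that] by (auto simp: FactGroup_def RCOSETS_def)
    show "?P #>\<^bsub>\<U>\<^esub> (s \<otimes>\<^bsub>\<U>\<^esub> t) = (?P #>\<^bsub>\<U>\<^esub> s) \<otimes>\<^bsub>\<U> Mod ?P\<^esub> (?P #>\<^bsub>\<U>\<^esub> t)" if "s \<in> Q" "t \<in> Q" for s t
      using P.rcos_sum QU that by (simp add: FactGroup_def)
  qed
  moreover have "{g \<in> Q. ?P #>\<^bsub>\<U>\<^esub> g = \<one>\<^bsub>\<U> Mod ?P\<^esub>} = Q \<inter> ?P"
    using QU U.coset_join1[OF _ _ P.subgroup_axioms] U.coset_join2[OF _ P.subgroup_axioms]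
    by (auto simp: FactGroup_def)
  ultimately have first: "folner_mod \<U> Q (Q \<inter> ?P)" by simp
  have "\<forall>x\<in>carrier \<U>. \<exists>\<theta>. (\<forall>p\<in>Q \<inter> ?P. \<theta> p \<in> carrier ?\<Gamma>) \<and>
    (\<forall>p\<in>Q \<inter> ?P. \<forall>q\<in>Q \<inter> ?P. \<theta> (p \<otimes> q) = \<theta> p \<otimes>\<^bsub>?\<Gamma>\<^esub> \<theta> q) \<and>
    (\<forall>p\<in>Q \<inter> ?P. \<theta> p = \<one>\<^bsub>?\<Gamma>\<^esub> \<longleftrightarrow> k \<otimes> x \<otimes> p = k \<otimes> x)"
    by (intro ballI hom_to_D_schutzenberger_group[OF U k _ sub]) simp_all
  then obtain \<theta> where \<theta>_all: "\<forall>x\<in>carrier \<U>. (\<forall>p\<in>Q \<inter> ?P. \<theta> x p \<in> carrier ?\<Gamma>) \<and>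
    (\<forall>p\<in>Q \<inter> ?P. \<forall>q\<in>Q \<inter> ?P. \<theta> x (p \<otimes> q) = \<theta> x p \<otimes>\<^bsub>?\<Gamma>\<^esub> \<theta> x q) \<and>
    (\<forall>p\<in>Q \<inter> ?P. \<theta> x p = \<one>\<^bsub>?\<Gamma>\<^esub> \<longleftrightarrow> k \<otimes> x \<otimes> p = k \<otimes> x)"
    by (rule bchoice[THEN exE]) (rule that)
  have \<theta>: "\<And>x p. x \<in> carrier \<U> \<Longrightarrow> p \<in> Q \<inter> ?P \<Longrightarrow> \<theta> x p \<in> carrier ?\<Gamma>"
    "\<And>x p q. x \<in> carrier \<U> \<Longrightarrow> p \<in> Q \<inter> ?P \<Longrightarrow> q \<in> Q \<inter> ?P \<Longrightarrow> \<theta> x (p \<otimes> q) = \<theta> x p \<otimes>\<^bsub>?\<Gamma>\<^esub> \<theta> x q"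
    "\<And>x p. x \<in> carrier \<U> \<Longrightarrow> p \<in> Q \<inter> ?P \<Longrightarrow> \<theta> x p = \<one>\<^bsub>?\<Gamma>\<^esub> \<longleftrightarrow> k \<otimes> x \<otimes> p = k \<otimes> x"
    using \<theta>_all by blast+
  let ?\<Pi> = "product_group (carrier \<U>) (\<lambda>_. ?\<Gamma>)"
  let ?\<Theta> = "\<lambda>p. \<lambda>x\<in>carrier \<U>. \<theta> x p"
  have \<Gamma>_group: "group ?\<Gamma>"
    using D_schutzenberger_group_eq[OF k] schutzenberger_group_is_group by metis
  have "folner_group ?\<Pi>"
    using \<Gamma> power_of_finite_group_folner[OF \<Gamma>_group]
      comm_group_imp_folner[OF comm_group_product_group[of "carrier \<U>" "\<lambda>_. ?\<Gamma>"]] by blast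
  then have "folner_mod \<U> (Q \<inter> ?P) {p \<in> Q \<inter> ?P. ?\<Theta> p = \<one>\<^bsub>?\<Pi>\<^esub>}"
    using \<Gamma>_group \<theta>(1,2) by (intro U.folner_mod_kernel[OF sub]) (auto simp: fun_eq_iff)
  moreover have "{p \<in> Q \<inter> ?P. ?\<Theta> p = \<one>\<^bsub>?\<Pi>\<^esub>} = Q \<inter> right_fixer k"
  proof -
    have "?\<Theta> p = \<one>\<^bsub>?\<Pi>\<^esub> \<longleftrightarrow> (\<forall>x\<in>carrier \<U>. k \<otimes> x \<otimes> p = k \<otimes> x)" if "p \<in> Q \<inter> ?P" for p
      using \<theta>(3)[OF _ that] by (auto simp: fun_eq_iff restrict_def)
    then show ?thesis using right_fixer_subset_class_fixer[OF k] QU by (auto simp: right_fixer_def)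
  qed
  ultimately have "folner_mod \<U> (Q \<inter> ?P) (Q \<inter> right_fixer k)" by simp
  then show ?thesis
    using right_fixer_subset_class_fixer[OF k] first
    by (intro U.folner_mod_trans[OF Q sub _ sub']) auto
qed

end

section \<open>Approximate actions\<close>

lemma proportion_le_iff:
  assumes "finite X" "X \<noteq> {}"
  shows "proportion X P \<le> \<epsilon> \<longleftrightarrow> real (card {x \<in> X. P x}) \<le> \<epsilon> * real (card X)"
proof -
  have "card X > 0" using assms by (simp add: card_gt_0_iff)
  then show ?thesis by (simp add: proportion_def field_simps)
qed

lemma proportion_ge_iff:
  assumes "finite X" "X \<noteq> {}"
  shows "1 - \<epsilon> \<le> proportion X P \<longleftrightarrow> real (card {x \<in> X. \<not> P x}) \<le> \<epsilon> * real (card X)"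
proof -
  have "card X = card {x \<in> X. P x} + card {x \<in> X. \<not> P x}"
    using assms(1) by (subst card_Un_disjoint[symmetric]) (auto intro!: arg_cong[where f = card])
  moreover have "card X > 0" using assms by (simp add: card_gt_0_iff)
  ultimately show ?thesis by (auto simp add: proportion_def field_simps)
qed

text \<open>Relabelling the points does not affect proportions, so approximate actions may be built on any
  convenient finite set.\<close>

lemma approx_action_on_nat:
  fixes X :: "'x set"
  assumes X: "finite X" "X \<noteq> {}" and act: "approx_action M K \<epsilon> X act" and M: "monoid M" "K \<subseteq> carrier M"
  shows "\<exists>(Y :: nat set) act'. finite Y \<and> Y \<noteq> {} \<and> approx_action M K \<epsilon> Y act'"
proof -
  interpret monoid M by fact
  obtain f :: "'x \<Rightarrow> nat" where f: "inj_on f X"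
    using finite_imp_inj_to_nat_seg[OF X(1)] by blast
  define r where "r = the_inv_into X f"
  have r: "r (f x) = x" if "x \<in> X" for x using the_inv_into_f_f[OF f that] by (simp add: r_def)
  define act' where "act' m y = f (act m (r y))" for m y
  have maps: "act m x \<in> X" if "m \<in> carrier M" "x \<in> X" for m x
    using act that by (auto simp: approx_action_def Pi_def)
  have transfer: "proportion (f ` X) P = proportion X (\<lambda>x. P (f x))" for P
  proof -
    have "{y \<in> f ` X. P y} = f ` {x \<in> X. P (f x)}" by auto
    then show ?thesis
      unfolding proportion_def by (simp add: card_image f inj_on_subset[OF f])
  qed
  have eq: "f a = f b \<longleftrightarrow> a = b" if "a \<in> X" "b \<in> X" for a b using inj_on_eq_iff[OF f that] .
  have cong: "proportion X P = proportion X Q" if "\<And>x. x \<in> X \<Longrightarrow> P x = Q x" for P Q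
  proof -
    have "{x \<in> X. P x} = {x \<in> X. Q x}" using that by auto
    then show ?thesis by (simp add: proportion_def)
  qed
  have "approx_action M K \<epsilon> (f ` X) act'"
    unfolding approx_action_def
  proof (intro conjI ballI impI)
    show "act' \<in> carrier M \<rightarrow> f ` X \<rightarrow> f ` X" using maps r by (auto simp: act'_def)
    show "act' \<one>\<^bsub>M\<^esub> x = x" if "x \<in> f ` X" for x
      using that act r by (auto simp: act'_def approx_action_def)
    fix g h assume gh: "g \<in> K" "h \<in> K"
    then have G: "g \<in> carrier M" "h \<in> carrier M" using M(2) by auto
    have "proportion (f ` X) (\<lambda>x. act' g (act' h x) = act' (g \<otimes>\<^bsub>M\<^esub> h) x) =
        proportion X (\<lambda>x. act g (act h x) = act (g \<otimes>\<^bsub>M\<^esub> h) x)"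
      unfolding transfer using maps G by (intro cong) (simp add: act'_def r eq)
    then show "1 - \<epsilon> \<le> proportion (f ` X) (\<lambda>x. act' g (act' h x) = act' (g \<otimes>\<^bsub>M\<^esub> h) x)"
      using act gh by (simp add: approx_action_def)
    have "proportion (f ` X) (\<lambda>x. act' g x = act' h x) = proportion X (\<lambda>x. act g x = act h x)"
      unfolding transfer using maps G by (intro cong) (simp add: act'_def r eq)
    then show "proportion (f ` X) (\<lambda>x. act' g x = act' h x) \<le> \<epsilon>" if "g \<noteq> h"
      using act gh that by (simp add: approx_action_def)
  qed
  then show ?thesis using X by (intro exI[of _ "f ` X"] exI[of _ act']) auto
qed

text \<open>The map \<open>\<phi>\<close> need not send the identity to the identity permutation, but almost
  multiplicativity at \<open>(1, 1)\<close> and injectivity of \<open>\<phi> 1\<close> force it to do so at most points. Replacing \<open>\<phi> 1\<close> by the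
  identity therefore doubles the error at most.\<close>

lemma sofic_group_imp_approx_action:
  fixes G (structure) and \<epsilon> :: real
  assumes sofic: "sofic_group G" and K: "finite K" "K \<subseteq> carrier G" and \<epsilon>: "\<epsilon> > 0"
  shows "\<exists>(X :: nat set) act. finite X \<and> X \<noteq> {} \<and> approx_action G K \<epsilon> X act"
proof -
  interpret group G using sofic by (simp add: sofic_group_def)
  define \<delta> where "\<delta> = \<epsilon> / 2"
  have \<delta>: "\<delta> > 0" using \<epsilon> by (simp add: \<delta>_def)
  let ?K = "insert \<one> K"
  have fin: "finite ?K" and sub: "?K \<subseteq> carrier G" using K by auto
  have "\<forall>K \<epsilon>. finite K \<longrightarrow> K \<subseteq> carrier G \<longrightarrow> \<epsilon> > 0 \<longrightarrow>
      (\<exists>(X::nat set) \<phi>. finite X \<and> X \<noteq> {} \<and> \<phi> \<in> carrier G \<rightarrow> carrier (BijGroup X) \<and>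
        (\<forall>g\<in>K. \<forall>h\<in>K. hamming_dist X (\<phi> (g \<otimes> h)) (\<phi> g \<otimes>\<^bsub>BijGroup X\<^esub> \<phi> h) \<le> \<epsilon>) \<and>
        (\<forall>g\<in>K. \<forall>h\<in>K. g \<noteq> h \<longrightarrow> hamming_dist X (\<phi> g) (\<phi> h) \<ge> 1 - \<epsilon>))"
    using sofic unfolding sofic_group_def by (rule conjunct2)
  from this[THEN spec, THEN spec, THEN mp, THEN mp, THEN mp, OF fin sub \<delta>]
  obtain X :: "nat set" and \<phi> where X: "finite X" "X \<noteq> {}"
    and \<phi>: "\<phi> \<in> carrier G \<rightarrow> carrier (BijGroup X)"
    and mult: "\<forall>g\<in>?K. \<forall>h\<in>?K. hamming_dist X (\<phi> (g \<otimes> h)) (\<phi> g \<otimes>\<^bsub>BijGroup X\<^esub> \<phi> h) \<le> \<delta>"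
    and free: "\<forall>g\<in>?K. \<forall>h\<in>?K. g \<noteq> h \<longrightarrow> hamming_dist X (\<phi> g) (\<phi> h) \<ge> 1 - \<delta>"
    by (elim exE conjE) (rule that)
  have bij: "\<phi> g \<in> Bij X" if "g \<in> carrier G" for g using \<phi> that by (auto simp: BijGroup_def)
  have maps: "\<phi> g x \<in> X" if "g \<in> carrier G" "x \<in> X" for g x
    using Bij_imp_funcset[OF bij] that by (auto simp: Pi_def)
  have KG: "g \<in> carrier G" if "g \<in> ?K" for g using that K by auto
  have bad: "real (card {x \<in> X. \<phi> g (\<phi> h x) \<noteq> \<phi> (g \<otimes> h) x}) \<le> \<delta> * real (card X)"
    if gh: "g \<in> ?K" "h \<in> ?K" for g h
  proof -
    have "\<phi> g \<in> Bij X" "\<phi> h \<in> Bij X" using bij KG gh by blast+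
    then have "(\<phi> g \<otimes>\<^bsub>BijGroup X\<^esub> \<phi> h) x = \<phi> g (\<phi> h x)" if "x \<in> X" for x
      using that by (simp add: BijGroup_def compose_def)
    then have "{x \<in> X. \<phi> g (\<phi> h x) \<noteq> \<phi> (g \<otimes> h) x} =
        {x \<in> X. \<phi> (g \<otimes> h) x \<noteq> (\<phi> g \<otimes>\<^bsub>BijGroup X\<^esub> \<phi> h) x}" by auto
    moreover have "hamming_dist X (\<phi> (g \<otimes> h)) (\<phi> g \<otimes>\<^bsub>BijGroup X\<^esub> \<phi> h) \<le> \<delta>" using mult gh by blast
    ultimately show ?thesis unfolding hamming_dist_def proportion_le_iff[OF X] by simp
  qed
  have same: "real (card {x \<in> X. \<phi> g x = \<phi> h x}) \<le> \<delta> * real (card X)"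
    if gh: "g \<in> ?K" "h \<in> ?K" "g \<noteq> h" for g h
    using free[rule_format, OF gh] unfolding hamming_dist_def proportion_ge_iff[OF X] by simp
  let ?E = "{x \<in> X. \<phi> \<one> x \<noteq> x}"
  have E: "real (card ?E) \<le> \<delta> * real (card X)"
  proof -
    have "inj_on (\<phi> \<one>) X" using bij[OF one_closed] by (auto simp: Bij_def bij_betw_def)
    then have "?E \<subseteq> {x \<in> X. \<phi> \<one> (\<phi> \<one> x) \<noteq> \<phi> (\<one> \<otimes> \<one>) x}"
      using maps[OF one_closed] by (auto dest: inj_onD)
    then have "card ?E \<le> card {x \<in> X. \<phi> \<one> (\<phi> \<one> x) \<noteq> \<phi> (\<one> \<otimes> \<one>) x}"
      using X by (intro card_mono) auto
    then show ?thesis using bad[of \<one> \<one>] by simp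
  qed
  have two: "real (card S) \<le> \<epsilon> * real (card X)"
    if "S \<subseteq> A \<union> ?E" "A \<subseteq> X" "real (card A) \<le> \<delta> * real (card X)" for S A
  proof -
    have "card S \<le> card (A \<union> ?E)" using that X finite_subset by (intro card_mono) auto
    also have "\<dots> \<le> card A + card ?E" by (rule card_Un_le)
    finally have "real (card S) \<le> real (card A) + real (card ?E)" by (simp flip: of_nat_add)
    also have "\<dots> \<le> \<epsilon> * real (card X)" using that(3) E by (simp add: \<delta>_def)
    finally show ?thesis .
  qed
  define act where "act g = (if g = \<one> then (\<lambda>x. x) else \<phi> g)" for g
  have "approx_action G K \<epsilon> X act"
    unfolding approx_action_def
  proof (intro conjI ballI impI)
    show "act \<in> carrier G \<rightarrow> X \<rightarrow> X" using maps by (auto simp: act_def)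
    show "act \<one> x = x" for x by (simp add: act_def)
    fix g h assume gh: "g \<in> K" "h \<in> K"
    have G: "g \<in> carrier G" "h \<in> carrier G" using gh K by auto
    have "{x \<in> X. act g (act h x) \<noteq> act (g \<otimes> h) x}
        \<subseteq> {x \<in> X. \<phi> g (\<phi> h x) \<noteq> \<phi> (g \<otimes> h) x} \<union> ?E"
      using G by (auto simp: act_def split: if_splits)
    then show "1 - \<epsilon> \<le> proportion X (\<lambda>x. act g (act h x) = act (g \<otimes> h) x)"
      unfolding proportion_ge_iff[OF X] by (rule two) (use bad gh in auto)
    assume ne: "g \<noteq> h"
    have "{x \<in> X. act g x = act h x} \<subseteq> {x \<in> X. \<phi> g x = \<phi> h x} \<union> ?E"
      using G ne by (auto simp: act_def split: if_splits)
    then show "proportion X (\<lambda>x. act g x = act h x) \<le> \<epsilon>"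
      unfolding proportion_le_iff[OF X] by (rule two) (use same gh ne in auto)
  qed
  then show ?thesis using X by blast
qed

context monoid
begin

text \<open>Points of the main part are triples \<open>(i, y, j)\<close>: \<open>i\<close> is a point of the approximation \<open>X1\<close> of the group of units,
  \<open>y\<close> represents a coset in an almost invariant set \<open>F\<close>, and \<open>j < n\<close> merely numbers copies that make the remainder
  \<open>Z\<close> negligible. A unit moves \<open>i\<close> by \<open>\<phi>\<close> and \<open>y\<close> by left multiplication modulo \<open>N\<close>; a non-unit \<open>m\<close> sends
  the triple to \<open>m y\<close>. Replacing \<open>h y\<close> by its representative in \<open>F\<close> does not change \<open>m h y\<close>, because \<open>N\<close>
  fixes \<open>m x\<close> for every unit \<open>x\<close>. Two units are separated by the coordinate \<open>i\<close>, two non-units since \<open>y\<close> can be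
  cancelled, and a unit from a non-unit since only the latter leaves the main part.\<close>

lemma exists_approx_action:
  fixes X1 :: "'x set" and \<epsilon> :: real
  assumes U: "group \<U>" and K: "finite K" "K \<subseteq> carrier G" and \<epsilon>: "\<epsilon> > 0"
    and X1: "finite X1" "X1 \<noteq> {}" "approx_action \<U> (K \<inter> carrier \<U>) (\<epsilon> / 4) X1 \<phi>"
    and N: "subgroup N \<U>" "folner_mod \<U> (carrier \<U>) N"
    and fixed: "\<And>k. k \<in> K - carrier \<U> \<Longrightarrow> N \<subseteq> right_fixer k"
  shows "\<exists>(X :: (('x \<times> 'a \<times> nat) + 'a) set) act. finite X \<and> X \<noteq> {} \<and> approx_action G K \<epsilon> X act"
proof -
  interpret U: group \<U> by fact
  define KU where "KU = K \<inter> carrier \<U>"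
  have KU: "finite KU" "KU \<subseteq> carrier \<U>" using K by (auto simp: KU_def)
  define K2 where "K2 = KU \<union> (KU <#> KU)"
  have K2: "finite K2" "K2 \<subseteq> carrier \<U>"
    using KU U.m_closed by (auto simp: K2_def set_mult_def)
  have "\<epsilon> / 8 > 0" using \<epsilon> by simp
  then obtain F where F: "finite F" "F \<noteq> {}" "F \<subseteq> carrier \<U>"
    and injF: "\<And>x y. x \<in> F \<Longrightarrow> y \<in> F \<Longrightarrow> inv\<^bsub>\<U>\<^esub> x \<otimes>\<^bsub>\<U>\<^esub> y \<in> N \<Longrightarrow> x = y"
    and badF: "\<And>k. k \<in> K2 \<Longrightarrow> real (card {x \<in> F. \<forall>y\<in>F. inv\<^bsub>\<U>\<^esub> y \<otimes>\<^bsub>\<U>\<^esub> (k \<otimes>\<^bsub>\<U>\<^esub> x) \<notin> N})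
        \<le> \<epsilon> / 8 * real (card F)"
    using folner_modE[OF N(2) K2] by blast
  have FU: "y \<in> carrier \<U>" if "y \<in> F" for y using F that by auto
  have FG: "y \<in> carrier G" if "y \<in> F" for y using FU that unit_closed by auto
  have NU: "n \<in> carrier \<U>" "n \<in> carrier G" if "n \<in> N" for n
    using subgroup.mem_carrier[OF N(1) that] unit_closed by auto
  define Bad where "Bad h = {x \<in> F. \<forall>y\<in>F. inv\<^bsub>\<U>\<^esub> y \<otimes> (h \<otimes> x) \<notin> N}" for h
  have coset: "inv\<^bsub>\<U>\<^esub> y \<otimes> u \<in> N \<longleftrightarrow> (\<exists>n\<in>N. u = y \<otimes> n)" if "y \<in> carrier \<U>" "u \<in> carrier \<U>" for y u
  proof
    assume "inv\<^bsub>\<U>\<^esub> y \<otimes> u \<in> N"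
    moreover have "u = y \<otimes> (inv\<^bsub>\<U>\<^esub> y \<otimes> u)" using U.mult_inv_cancel_left(1)[OF that] by simp
    ultimately show "\<exists>n\<in>N. u = y \<otimes> n" by blast
  next
    assume "\<exists>n\<in>N. u = y \<otimes> n"
    then show "inv\<^bsub>\<U>\<^esub> y \<otimes> u \<in> N" using U.mult_inv_cancel_left(2)[OF that(1)] NU by auto
  qed
  \<comment> \<open>left multiplication by \<open>h\<close> on \<open>F\<close> modulo \<open>N\<close>, where it stays in \<open>F\<close>; elsewhere points are left in place\<close>
  define \<tau> where "\<tau> h y = (if y \<in> Bad h then y else SOME y'. y' \<in> F \<and> inv\<^bsub>\<U>\<^esub> y' \<otimes> (h \<otimes> y) \<in> N)" for h y
  have UU: "g \<otimes> h \<in> carrier \<U>" if "g \<in> carrier \<U>" "h \<in> carrier \<U>" for g h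
    using U.m_closed[OF that] by simp
  have \<tau>_good: "\<tau> h y \<in> F \<and> (\<exists>n\<in>N. h \<otimes> y = \<tau> h y \<otimes> n)"
    if h: "h \<in> carrier \<U>" and y: "y \<in> F" "y \<notin> Bad h" for h y
  proof -
    have "\<exists>y'. y' \<in> F \<and> inv\<^bsub>\<U>\<^esub> y' \<otimes> (h \<otimes> y) \<in> N" using y by (auto simp: Bad_def)
    from someI_ex[OF this] have "\<tau> h y \<in> F \<and> inv\<^bsub>\<U>\<^esub> \<tau> h y \<otimes> (h \<otimes> y) \<in> N"
      using y(2) by (simp add: \<tau>_def)
    then show ?thesis using coset[of "\<tau> h y" "h \<otimes> y"] FU UU h y(1) by blast
  qed
  have \<tau>F: "\<tau> h y \<in> F" if "h \<in> carrier \<U>" "y \<in> F" for h y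
    using \<tau>_good[OF that] that by (cases "y \<in> Bad h") (auto simp: \<tau>_def)
  have \<tau>_unique: "y \<notin> Bad h \<and> \<tau> h y = y'"
    if h: "h \<in> carrier \<U>" and y: "y \<in> F" "y' \<in> F" "n \<in> N" "h \<otimes> y = y' \<otimes> n" for h y y' n
  proof -
    have "inv\<^bsub>\<U>\<^esub> y' \<otimes> (h \<otimes> y) \<in> N" using coset[of y' "h \<otimes> y"] FU UU h y by blast
    then have good: "y \<notin> Bad h" using y(2) unfolding Bad_def by blast
    obtain n' where n': "n' \<in> N" "h \<otimes> y = \<tau> h y \<otimes> n'" using \<tau>_good[OF h y(1) good] by blast
    have tF: "\<tau> h y \<in> F" using \<tau>F h y by simp
    note c = FG[OF tF] FG[OF y(2)] NU(2)[OF n'(1)] NU(2)[OF y(3)]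
    have i: "inv\<^bsub>\<U>\<^esub> n \<in> N" using subgroup.m_inv_closed[OF N(1) y(3)] .
    have nn: "n \<otimes> inv\<^bsub>\<U>\<^esub> n = \<one>" using U.r_inv NU(1)[OF y(3)] by simp
    have "\<tau> h y \<otimes> n' \<otimes> inv\<^bsub>\<U>\<^esub> n = y' \<otimes> n \<otimes> inv\<^bsub>\<U>\<^esub> n" using n'(2) y(4) by simp
    then have "y' = \<tau> h y \<otimes> (n' \<otimes> inv\<^bsub>\<U>\<^esub> n)" using c nn NU(2)[OF i] by (simp add: m_assoc)
    moreover have "n' \<otimes> inv\<^bsub>\<U>\<^esub> n \<in> N" using subgroup.m_closed[OF N(1) n'(1) i] by simp
    ultimately have "inv\<^bsub>\<U>\<^esub> \<tau> h y \<otimes> y' \<in> N" using coset[of "\<tau> h y" y'] FU tF y(2) by blast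
    then show ?thesis using injF[of "\<tau> h y" y'] tF y(2) good by simp
  qed
  have \<tau>_one: "\<tau> \<one> y = y" if "y \<in> F" for y
  proof -
    have "\<one> \<in> N" using subgroup.one_closed[OF N(1)] by simp
    then show ?thesis using \<tau>_unique[of \<one> y y \<one>] U.one_closed that FG by simp
  qed
  have \<tau>_mult: "\<tau> g (\<tau> h y) = \<tau> (g \<otimes> h) y"
    if gh: "g \<in> carrier \<U>" "h \<in> carrier \<U>" and y: "y \<in> F" "y \<notin> Bad h" "y \<notin> Bad (g \<otimes> h)" for g h y
  proof -
    obtain n where n: "n \<in> N" "h \<otimes> y = \<tau> h y \<otimes> n" using \<tau>_good gh y by blast
    obtain n' where n': "n' \<in> N" "g \<otimes> h \<otimes> y = \<tau> (g \<otimes> h) y \<otimes> n'" using \<tau>_good[OF UU] gh y by blast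
    have tF: "\<tau> h y \<in> F" "\<tau> (g \<otimes> h) y \<in> F" using \<tau>F UU gh y by auto
    have i: "inv\<^bsub>\<U>\<^esub> n \<in> N" using subgroup.m_inv_closed[OF N(1) n(1)] .
    have nn: "n \<otimes> inv\<^bsub>\<U>\<^esub> n = \<one>" using U.r_inv NU(1)[OF n(1)] by simp
    note c = FG[OF tF(1)] FG[OF tF(2)] NU(2)[OF n'(1)] NU(2)[OF n(1)] NU(2)[OF i]
      unit_closed[OF gh(1)] unit_closed[OF gh(2)] FG[OF y(1)]
    have "g \<otimes> \<tau> h y = g \<otimes> (\<tau> h y \<otimes> n) \<otimes> inv\<^bsub>\<U>\<^esub> n" using c nn by (simp add: m_assoc)
    also have "\<dots> = g \<otimes> h \<otimes> y \<otimes> inv\<^bsub>\<U>\<^esub> n" using c by (simp add: m_assoc flip: n(2))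
    also have "\<dots> = \<tau> (g \<otimes> h) y \<otimes> (n' \<otimes> inv\<^bsub>\<U>\<^esub> n)" using c unfolding n'(2) by (simp add: m_assoc)
    finally have "g \<otimes> \<tau> h y = \<tau> (g \<otimes> h) y \<otimes> (n' \<otimes> inv\<^bsub>\<U>\<^esub> n)" .
    moreover have "n' \<otimes> inv\<^bsub>\<U>\<^esub> n \<in> N" using subgroup.m_closed[OF N(1) n'(1) i] by simp
    ultimately show ?thesis using \<tau>_unique[OF gh(1) tF] by blast
  qed
  have \<tau>_nonunit: "k \<otimes> \<tau> h y = k \<otimes> h \<otimes> y"
    if k: "k \<in> K - carrier \<U>" and h: "h \<in> carrier \<U>" and y: "y \<in> F" "y \<notin> Bad h" for k h y
  proof -
    obtain n where n: "n \<in> N" "h \<otimes> y = \<tau> h y \<otimes> n" using \<tau>_good h y by blast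
    have tF: "\<tau> h y \<in> F" using \<tau>F h y by auto
    have kG: "k \<in> carrier G" using k K by auto
    have "k \<otimes> h \<otimes> y = k \<otimes> (h \<otimes> y)" using kG unit_closed[OF h] FG[OF y(1)] by (simp add: m_assoc)
    also have "\<dots> = k \<otimes> \<tau> h y \<otimes> n" unfolding n(2) using kG FG[OF tF] NU(2)[OF n(1)] by (simp add: m_assoc)
    also have "\<dots> = k \<otimes> \<tau> h y" using fixed[OF k] n(1) FU[OF tF] by (auto simp: right_fixer_def)
    finally show ?thesis by simp
  qed
  \<comment> \<open>all values needed below; the identity only serves as a default outside these\<close>
  define Z where "Z = insert \<one> ((\<lambda>(m, y). m \<otimes> y) ` ((K \<union> (K <#> K)) \<times> F))"
  have Z: "finite Z" "\<one> \<in> Z" using K F by (auto simp: Z_def set_mult_def)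
  have ZK: "k \<otimes> y \<in> Z" if "k \<in> K" "y \<in> F" for k y using that by (force simp: Z_def)
  have ZKK: "k \<otimes> h \<otimes> y \<in> Z" if "k \<in> K" "h \<in> K" "y \<in> F" for k h y
    using that by (force simp: Z_def set_mult_def)
  have ZG: "z \<in> carrier G" if "z \<in> Z" for z
    using that K FG by (auto simp: Z_def set_mult_def subset_iff)
  define n where "n = Suc (nat \<lceil>4 * real (card Z) / \<epsilon>\<rceil>)"
  have n: "real (card Z) \<le> \<epsilon> / 4 * real n"
  proof -
    have "4 * real (card Z) / \<epsilon> \<le> real n" unfolding n_def by linarith
    then show ?thesis using \<epsilon> by (simp add: field_simps)
  qed
  define X where "X = Inl ` (X1 \<times> F \<times> {..<n}) \<union> Inr ` Z"
  have X: "finite X" "X \<noteq> {}" using X1 F Z by (auto simp: X_def)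
  define c where "c z = (if z \<in> Z then z else \<one>)" for z
  have c: "c z \<in> Z" "z \<in> Z \<Longrightarrow> c z = z" for z using Z by (auto simp: c_def)
  define act where "act m x = (case x of
      Inl (i, y, j) \<Rightarrow> if m \<in> carrier \<U> then Inl (\<phi> m i, \<tau> m y, j) else Inr (c (m \<otimes> y))
    | Inr z \<Rightarrow> Inr (c (m \<otimes> z)))" for m and x :: "('x \<times> 'a \<times> nat) + 'a"
  have small: "real (card S) \<le> \<epsilon> * real (card X)"
    if S: "S \<subseteq> Inr ` Z \<union> Inl ` (A1 \<times> F \<times> {..<n}) \<union> Inl ` (X1 \<times> A2 \<times> {..<n})"
      and A: "finite A1" "finite A2" "real (card A1) \<le> \<epsilon> / 4 * real (card X1)" "real (card A2) \<le> \<epsilon> / 4 * real (card F)"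
    for S :: "(('x \<times> 'a \<times> nat) + 'a) set" and A1 A2
  proof -
    let ?T = "Inr ` Z \<union> Inl ` (A1 \<times> F \<times> {..<n}) \<union> Inl ` (X1 \<times> A2 \<times> {..<n})"
    have "card S \<le> card ?T" using S A(1,2) Z F X1 by (intro card_mono) auto
    also have "\<dots> \<le> card (Inr ` Z :: (('x \<times> 'a \<times> nat) + 'a) set) + card (Inl ` (A1 \<times> F \<times> {..<n}) :: (('x \<times> 'a \<times> nat) + 'a) set)
        + card (Inl ` (X1 \<times> A2 \<times> {..<n}) :: (('x \<times> 'a \<times> nat) + 'a) set)"
      by (intro order_trans[OF card_Un_le] add_mono card_Un_le order_refl)
    also have "\<dots> = card Z + card A1 * (card F * n) + card X1 * (card A2 * n)"
      by (simp add: card_image card_cartesian_product)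
    finally have "real (card S) \<le> real (card Z + card A1 * (card F * n) + card X1 * (card A2 * n))"
      by (simp only: of_nat_le_iff)
    also have "\<dots> = real (card Z) + real (card A1) * (real (card F) * real n) + real (card X1) * (real (card A2) * real n)"
      by simp
    also have "\<dots> \<le> \<epsilon> / 4 * (real (card X1) * real (card F) * real n)
        + (\<epsilon> / 4 * real (card X1)) * (real (card F) * real n)
        + real (card X1) * ((\<epsilon> / 4 * real (card F)) * real n)"
    proof (intro add_mono mult_left_mono mult_right_mono A(3,4))
      have "1 \<le> card X1 * card F" using X1 F by (simp add: Suc_le_eq card_gt_0_iff)
      then have "1 \<le> real (card X1) * real (card F)" by (metis of_nat_1 of_nat_le_iff of_nat_mult)
      then have "1 * real n \<le> real (card X1) * real (card F) * real n" by (rule mult_right_mono) simp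
      then have "\<epsilon> / 4 * real n \<le> \<epsilon> / 4 * (real (card X1) * real (card F) * real n)"
        using \<epsilon> by (intro mult_left_mono) auto
      then show "real (card Z) \<le> \<epsilon> / 4 * (real (card X1) * real (card F) * real n)" using n by linarith
    qed auto
    also have "\<dots> \<le> \<epsilon> * (real (card X1) * real (card F) * real n)"
      using \<epsilon> by (simp add: field_simps)
    also have "real (card X1) * real (card F) * real n = real (card (Inl ` (X1 \<times> F \<times> {..<n}) :: (('x \<times> 'a \<times> nat) + 'a) set))"
      by (simp add: card_image card_cartesian_product)
    also have "\<epsilon> * \<dots> \<le> \<epsilon> * real (card X)"
      using \<epsilon> X by (intro mult_left_mono) (auto simp: X_def intro!: card_mono)
    finally show ?thesis .
  qed
  have \<phi>: "\<phi> m i \<in> X1" if "m \<in> carrier \<U>" "i \<in> X1" for m i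
    using X1(3) that by (auto simp: approx_action_def Pi_def)
  have "approx_action G K \<epsilon> X act"
    unfolding approx_action_def
  proof (intro conjI ballI impI)
    show "act \<in> carrier G \<rightarrow> X \<rightarrow> X"
      using \<phi> \<tau>F c(1) by (auto simp: act_def X_def)
    show "act \<one> x = x" if "x \<in> X" for x
    proof -
      have "\<phi> \<one> i = i" if "i \<in> X1" for i using X1(3) that by (auto simp: approx_action_def)
      then show ?thesis
        using that \<tau>_one U.one_closed c(2) ZG by (auto simp: act_def X_def)
    qed
    fix g h assume gh: "g \<in> K" "h \<in> K"
    have ghG: "g \<in> carrier G" "h \<in> carrier G" using gh K by auto
    \<comment> \<open>the coordinates at which compatibility may fail; when \<open>h\<close> is a non-unit it holds on the whole main part\<close>
    define A1 where "A1 = (if g \<in> carrier \<U> \<and> h \<in> carrier \<U> then {i \<in> X1. \<phi> g (\<phi> h i) \<noteq> \<phi> (g \<otimes> h) i} else {})"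
    define A2 where "A2 = (if h \<notin> carrier \<U> then {} else if g \<in> carrier \<U> then Bad h \<union> Bad (g \<otimes> h) else Bad h)"
    have prod: "act g (act h (Inl (i, y, j))) = act (g \<otimes> h) (Inl (i, y, j))"
      if iy: "i \<in> X1" "i \<notin> A1" "y \<in> F" "y \<notin> A2" for i y j
    proof (cases "h \<in> carrier \<U>")
      case hU: True
      show ?thesis
      proof (cases "g \<in> carrier \<U>")
        case gU: True
        then have "\<phi> g (\<phi> h i) = \<phi> (g \<otimes> h) i" "\<tau> g (\<tau> h y) = \<tau> (g \<otimes> h) y"
          using iy hU \<tau>_mult by (auto simp: A1_def A2_def)
        then show ?thesis using gU hU UU by (simp add: act_def)
      next
        case gN: False
        then have "g \<otimes> h \<notin> carrier \<U>" using factor_of_unit_is_unit ghG by blast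
        moreover have "g \<otimes> \<tau> h y = g \<otimes> h \<otimes> y"
          using \<tau>_nonunit[of g h y] gN gh hU iy by (auto simp: A2_def)
        ultimately show ?thesis using gN hU by (simp add: act_def)
      qed
    next
      case hN: False
      then have "g \<otimes> h \<notin> carrier \<U>" using factor_of_unit_is_unit ghG by blast
      moreover have "g \<otimes> (h \<otimes> y) = g \<otimes> h \<otimes> y" using ghG FG[OF iy(3)] by (simp add: m_assoc)
      ultimately show ?thesis using hN c(2) ZK gh iy by (simp add: act_def)
    qed
    show "1 - \<epsilon> \<le> proportion X (\<lambda>x. act g (act h x) = act (g \<otimes> h) x)"
      unfolding proportion_ge_iff[OF X]
    proof (rule small)
      show "{x \<in> X. act g (act h x) \<noteq> act (g \<otimes> h) x}
          \<subseteq> Inr ` Z \<union> Inl ` (A1 \<times> F \<times> {..<n}) \<union> Inl ` (X1 \<times> A2 \<times> {..<n})"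
        using prod by (fastforce simp: X_def)
      show "finite A1" "finite A2" using X1 F by (auto simp: A1_def A2_def Bad_def)
      show "real (card A1) \<le> \<epsilon> / 4 * real (card X1)"
      proof (cases "g \<in> carrier \<U> \<and> h \<in> carrier \<U>")
        case True
        then have "1 - \<epsilon> / 4 \<le> proportion X1 (\<lambda>i. \<phi> g (\<phi> h i) = \<phi> (g \<otimes> h) i)"
          using X1(3) gh by (auto simp: approx_action_def)
        then show ?thesis using True unfolding proportion_ge_iff[OF X1(1,2)] by (simp add: A1_def)
      qed (use \<epsilon> in \<open>auto simp: A1_def\<close>)
      have small_bad: "real (card (Bad k)) \<le> \<epsilon> / 8 * real (card F)" if "k \<in> K2" for k
        using badF[OF that] by (simp add: Bad_def)
      show "real (card A2) \<le> \<epsilon> / 4 * real (card F)"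
      proof (cases "h \<in> carrier \<U>")
        case hU: True
        then have hK: "h \<in> K2" using gh by (simp add: K2_def KU_def)
        show ?thesis
        proof (cases "g \<in> carrier \<U>")
          case True
          then have "g \<otimes> h \<in> K2" using gh hU by (auto simp: K2_def KU_def set_mult_def)
          then have "real (card (Bad h)) + real (card (Bad (g \<otimes> h))) \<le> \<epsilon> / 4 * real (card F)"
            using small_bad[OF hK] small_bad[of "g \<otimes> h"] by linarith
          moreover have "card A2 \<le> card (Bad h) + card (Bad (g \<otimes> h))"
            using True hU by (simp add: A2_def card_Un_le)
          then have "real (card A2) \<le> real (card (Bad h)) + real (card (Bad (g \<otimes> h)))"
            by (simp flip: of_nat_add)
          ultimately show ?thesis by linarith
        next
          case False
          have "\<epsilon> / 8 * real (card F) \<le> \<epsilon> / 4 * real (card F)" using \<epsilon> by (intro mult_right_mono) auto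
          then show ?thesis using False hU small_bad[OF hK] by (simp add: A2_def)
        qed
      qed (use \<epsilon> in \<open>auto simp: A2_def\<close>)
    qed
    assume ne: "g \<noteq> h"
    define C where "C = (if g \<in> carrier \<U> \<and> h \<in> carrier \<U> then {i \<in> X1. \<phi> g i = \<phi> h i} else {})"
    have sep: "i \<in> C" if iy: "i \<in> X1" "y \<in> F" and eq: "act g (Inl (i, y, j)) = act h (Inl (i, y, j))" for i y j
    proof (cases "g \<in> carrier \<U> \<or> h \<in> carrier \<U>")
      case True
      then show ?thesis using eq iy by (auto simp: C_def act_def split: if_splits)
    next
      case False
      then have "g \<otimes> y = h \<otimes> y" using eq c(2) ZK gh iy by (auto simp: act_def)
      moreover have "y \<otimes> inv\<^bsub>\<U>\<^esub> y = \<one>" using U.r_inv FU[OF iy(2)] by simp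
      moreover have "inv\<^bsub>\<U>\<^esub> y \<in> carrier G" using U.inv_closed FU[OF iy(2)] unit_closed by blast
      ultimately have "g = h" using ghG FG[OF iy(2)] by (metis m_assoc r_one)
      then show ?thesis using ne by simp
    qed
    show "proportion X (\<lambda>x. act g x = act h x) \<le> \<epsilon>"
      unfolding proportion_le_iff[OF X]
    proof (rule small)
      show "{x \<in> X. act g x = act h x} \<subseteq> Inr ` Z \<union> Inl ` (C \<times> F \<times> {..<n}) \<union> Inl ` (X1 \<times> {} \<times> {..<n})"
        using sep by (fastforce simp: X_def)
      show "finite C" using X1 by (simp add: C_def)
      show "real (card C) \<le> \<epsilon> / 4 * real (card X1)"
      proof (cases "g \<in> carrier \<U> \<and> h \<in> carrier \<U>")
        case True
        then have "proportion X1 (\<lambda>i. \<phi> g i = \<phi> h i) \<le> \<epsilon> / 4"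
          using X1(3) gh ne by (auto simp: approx_action_def)
        then show ?thesis using True unfolding proportion_le_iff[OF X1(1,2)] by (simp add: C_def)
      qed (use \<epsilon> in \<open>auto simp: C_def\<close>)
    qed (use \<epsilon> in auto)
  qed
  then show ?thesis using X by blast
qed

lemma D_class_of_nonunit:
  assumes k: "k \<in> carrier G - carrier \<U>"
  shows "green_D G `` {k} \<subseteq> carrier G - carrier \<U>"
proof
  fix y assume "y \<in> green_D G `` {k}"
  then obtain z where z: "(k, z) \<in> green_L G" "(z, y) \<in> green_R G" by (auto simp: green_D_def)
  then have yG: "y \<in> carrier G" by (simp add: green_R_iff)
  moreover have "y \<notin> carrier \<U>"
  proof
    assume y: "y \<in> carrier \<U>"
    obtain a where "a \<in> carrier G" "z \<in> carrier G" "y = z \<otimes> a" using z(2) by (auto simp: green_R_iff)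
    then have zU: "z \<in> carrier \<U>" using factor_of_unit_is_unit y by blast
    obtain b where "b \<in> carrier G" "z = b \<otimes> k" using z(1) by (auto simp: green_L_iff)
    then have "k \<in> carrier \<U>" using factor_of_unit_is_unit zU k by blast
    then show False using k by simp
  qed
  ultimately show "y \<in> carrier G - carrier \<U>" by simp
qed

text \<open>The finitely many non-units are treated one after the other, applying the hypothesis to the
  subgroup obtained so far and composing by \<open>folner_mod_trans\<close>.\<close>

lemma folner_mod_common_fixer:
  assumes U: "group \<U>" and S: "finite S" "S \<subseteq> carrier G"
    and fol: "\<And>k Q. k \<in> S \<Longrightarrow> subgroup Q \<U> \<Longrightarrow> folner_mod \<U> Q (Q \<inter> right_fixer k)"
  shows "subgroup {g \<in> carrier \<U>. \<forall>k\<in>S. g \<in> right_fixer k} \<U> \<and>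
    folner_mod \<U> (carrier \<U>) {g \<in> carrier \<U>. \<forall>k\<in>S. g \<in> right_fixer k}"
  using S fol
proof (induction S)
  case empty
  interpret U: group \<U> by fact
  have "inv\<^bsub>\<U>\<^esub> x \<otimes>\<^bsub>\<U>\<^esub> y \<in> carrier \<U>" if "x \<in> carrier \<U>" "y \<in> carrier \<U>" for x y
    using U.m_closed[OF U.inv_closed that(2)] that(1) .
  then have "folner_mod \<U> (carrier \<U>) (carrier \<U>)"
    by (intro U.folner_mod_finite_index[OF U.subgroup_self U.subgroup_self, of "\<lambda>_. ()"]) auto
  then show ?case using U.subgroup_self by simp
next
  case (insert k S)
  interpret U: group \<U> by fact
  let ?N = "{g \<in> carrier \<U>. \<forall>k\<in>S. g \<in> right_fixer k}"
  have IH: "subgroup ?N \<U>" "folner_mod \<U> (carrier \<U>) ?N" using insert by auto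
  have eq: "{g \<in> carrier \<U>. \<forall>k\<in>insert k S. g \<in> right_fixer k} = ?N \<inter> right_fixer k" by auto
  have k: "k \<in> carrier G" using insert.prems by simp
  have sub: "subgroup (?N \<inter> right_fixer k) \<U>"
    using IH(1) subgroup_right_fixer[OF U k] by (rule U.subgroups_Inter_pair)
  have "folner_mod \<U> ?N (?N \<inter> right_fixer k)" using insert.prems(2) IH(1) by simp
  then have "folner_mod \<U> (carrier \<U>) (?N \<inter> right_fixer k)"
    by (intro U.folner_mod_trans[OF U.subgroup_self IH(1) _ sub _ IH(2)]) auto
  then show ?case using sub unfolding eq by simp
qed

end

section \<open>Soficity\<close>

theorem theorem4p1:
  fixes M :: "('a, 'b) monoid_scheme"
  assumes "monoid M"
    and "sofic_group (J_class_of_one M)"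
    and "\<And>D. D \<in> carrier M // green_D M \<Longrightarrow>
           D \<subseteq> carrier M - carrier (J_class_of_one M) \<Longrightarrow>
           (finite {L \<in> carrier M // green_L M. L \<subseteq> D} \<and>
            amenable_group (D_schutzenberger_group M D)) \<or>
           ((finite (carrier (D_schutzenberger_group M D)) \<or>
             comm_group (D_schutzenberger_group M D)) \<and>
            locally_amenable (J_class_of_one M)
              {H \<in> carrier M // green_H M. H \<subseteq> D} (circ_action M))"
  shows "sofic_monoid M"
proof -
  interpret monoid M by fact
  let ?U = "J_class_of_one M"
  have U: "group ?U" using assms(2) by (simp add: sofic_group_def)
  have fol: "folner_mod ?U Q (Q \<inter> right_fixer k)"
    if k: "k \<in> carrier M - carrier ?U" and Q: "subgroup Q ?U" for k Q
  proof -
    let ?D = "green_D M `` {k}"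
    have kM: "k \<in> carrier M" using k by simp
    consider "finite {L \<in> carrier M // green_L M. L \<subseteq> ?D}"
        "amenable_group (D_schutzenberger_group M ?D)"
      | "finite (carrier (D_schutzenberger_group M ?D)) \<or> comm_group (D_schutzenberger_group M ?D)"
        "locally_amenable ?U {H \<in> carrier M // green_H M. H \<subseteq> ?D} (circ_action M)"
      using assms(3)[OF quotientI[OF kM] D_class_of_nonunit[OF k]] by blast
    then show ?thesis
    proof cases
      case 1
      then show ?thesis
        using folner_mod_right_fixer_finite_L[OF U kM Q] amenable_imp_folner
        by (auto simp: amenable_group_def)
    next
      case 2
      then show ?thesis by (rule folner_mod_right_fixer_locally_amenable[OF U kM Q])
    qed
  qed
  show ?thesis
    unfolding sofic_monoid_def
  proof (intro conjI allI impI)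
    fix K and \<epsilon> :: real assume K: "finite K" "K \<subseteq> carrier M" and \<epsilon>: "\<epsilon> > 0"
    let ?S = "K - carrier ?U"
    let ?N = "{g \<in> carrier ?U. \<forall>k\<in>?S. g \<in> right_fixer k}"
    have "subgroup ?N ?U \<and> folner_mod ?U (carrier ?U) ?N"
      using K by (intro folner_mod_common_fixer[OF U] fol) auto
    then have N: "subgroup ?N ?U" "folner_mod ?U (carrier ?U) ?N" by auto
    have KU: "finite (K \<inter> carrier ?U)" "K \<inter> carrier ?U \<subseteq> carrier ?U" "\<epsilon> / 4 > 0" using K \<epsilon> by auto
    obtain X1 :: "nat set" and \<phi> where
      X1: "finite X1" "X1 \<noteq> {}" "approx_action ?U (K \<inter> carrier ?U) (\<epsilon> / 4) X1 \<phi>"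
      using sofic_group_imp_approx_action[OF assms(2) KU] by blast
    have "?N \<subseteq> right_fixer k" if "k \<in> ?S" for k using that by blast
    from exists_approx_action[OF U K \<epsilon> X1 N this]
    obtain X :: "((nat \<times> 'a \<times> nat) + 'a) set" and act
      where "finite X" "X \<noteq> {}" "approx_action M K \<epsilon> X act" by blast
    then show "\<exists>(X :: nat set) act. finite X \<and> X \<noteq> {} \<and> approx_action M K \<epsilon> X act"
      using approx_action_on_nat[OF _ _ _ \<open>monoid M\<close> K(2)] by blast
  qed fact
qed

end
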